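(* Let $n\ge3$ be odd and let $f=a_1x_1^2+\dots+a_nx_n^2$ with $a_i\in\mathbb{F}_q^\times$. Then for every integer $P\ge1$: if $n=3$, $$N(P)=\begin{cases}\frac{q^2-1}{2q}Pq^P+q^P&\text{if }2\mid P,\\ \frac{q^2-1}{2q}Pq^P+\frac{q^2+1}{2q}\,q^P&\text{if }2\nmid P,\end{cases}$$ and if $n\ge5$, $$N(P)=\begin{cases}\frac{q^{n-1}-1}{q^{n-2}-q}\,q^{P(n-2)}-(q-1)\frac{q^{n-2}+1}{q^{n-2}-q}\,q^{\frac{n-1}2P}&\text{if }2\mid P,\\ \frac{q^{n-1}-1}{q^{n-2}-q}\,q^{P(n-2)}-\frac{(q^2-1)q^{(n-3)/2}}{q^{n-2}-q}\,q^{\frac{n-1}2P}&\text{if }2\nmid P.\end{cases}$$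
   Context: $q$ is a power of an odd prime. $N(P)=\#\{\mathbf{x}\in\mathbb{F}_q[t]^n:\deg(x_i)<P\text{ for all }i,\ f(\mathbf{x})=0\}$ (with the convention $\deg 0=-\infty$, so $\mathbf{x}=\mathbf{0}$ is counted). *)

theory Defs
  imports "HOL-Computational_Algebra.Polynomial" "HOL-Library.Cardinality"
begin

text \<open>The finite field F_q is modelled by a finite type 'a of class field;
q = CARD('a). Vectors in F_q[t]^n are functions nat => 'a poly that vanish
outside {0..<n}. The degree condition deg x_i < P uses the convention
deg 0 = -infinity, i.e. x_i = 0 is always allowed.\<close>

definition diag_form :: "nat \<Rightarrow> (nat \<Rightarrow> 'a::field) \<Rightarrow> (nat \<Rightarrow> 'a poly) \<Rightarrow> 'a poly" where
  "diag_form n a x = (\<Sum>i<n. smult (a i) (x i ^ 2))"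

definition count_N :: "nat \<Rightarrow> (nat \<Rightarrow> 'a::{field,finite}) \<Rightarrow> nat \<Rightarrow> nat" where
  "count_N n a P = card {x :: nat \<Rightarrow> 'a poly.
      (\<forall>i. n \<le> i \<longrightarrow> x i = 0) \<and>
      (\<forall>i<n. x i = 0 \<or> degree (x i) < P) \<and>
      diag_form n a x = 0}"

end

theory Submission
  imports Defs "HOL-Computational_Algebra.Polynomial_FPS" "HOL-Library.FuncSet"
begin

text \<open>Detect \<open>f(x) = 0\<close> by summing over all linear functionals on polynomials of degree at most
  \<open>2P - 2\<close>. A functional composed with \<open>x \<mapsto> x\<^sup>2\<close> is a Hankel form, encoded by a truncated power
  series \<open>A = X\<^sup>k U\<close> with \<open>U\<close> a unit. The substitution \<open>y = U x\<close>, one step of the Euclidean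
  algorithm, splits this form orthogonally into an anti-triangular block of size \<open>k + 1\<close>, depending on
  the first coefficients of \<open>1/U\<close>, and a Hankel form given by the remaining coefficients of \<open>1/U\<close>.
  Blocks of even size are hyperbolic; those of odd size cancel on average, because scaling the leading
  coefficient by a nonsquare flips the sign of a Gauss sum in an odd number \<open>n\<close> of variables. This
  gives \<open>N(P + 2) = q\<^sup>n\<^sup>-\<^sup>1 N(P) + q\<^bsup>(n-2)(P+1)\<^esup> (q\<^sup>n\<^sup>-\<^sup>1 - 1)\<close> with \<open>N(0) = 1\<close> and \<open>N(1) = q\<^sup>n\<^sup>-\<^sup>1\<close>.\<close>

unbundle fps_syntax

section \<open>Diagonal forms over the finite field\<close>

text \<open>If 2 = 0, the two-element sets \<open>{x, x + 1}\<close> partition the field, so its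
  cardinality is even.\<close>

lemma two_neq_zero_if_odd_card:
  assumes "odd (CARD('a::{field,finite}))"
  shows "(2::'a) \<noteq> 0"
proof
  assume two: "(2::'a) = 0"
  define C where "C = (\<lambda>x::'a. {x, x + 1}) ` UNIV"
  have inv: "x + 1 + 1 = x" for x :: 'a
    using two by (metis add.assoc add.right_neutral one_add_one)
  have "2 * card C = card (\<Union>C)"
  proof (rule card_partition)
    show "c1 \<inter> c2 = {}" if "c1 \<in> C" "c2 \<in> C" "c1 \<noteq> c2" for c1 c2
    proof -
      obtain x y where [simp]: "c1 = {x, x + 1}" "c2 = {y, y + 1}" using \<open>c1 \<in> C\<close> \<open>c2 \<in> C\<close> by (auto simp: C_def)
      show ?thesis
        using \<open>c1 \<noteq> c2\<close> by (auto simp: inv insert_commute)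
    qed
  qed (auto simp: C_def)
  moreover have "\<Union>C = UNIV" by (auto simp: C_def)
  ultimately have "even (CARD('a))" by (metis dvd_triv_left)
  with assms show False by simp
qed

text \<open>Take any nonsquare \<open>e\<close>. Squaring is two-to-one on the nonzero elements, so
  exactly half of them lie in the set \<open>S\<close> of squares; \<open>S\<close> and
  \<open>e * S\<close> are disjoint and hence cover them all. This stands in for the quadratic
  character.\<close>

lemma nonsquare_cover:
  assumes "odd (CARD('a::{field,finite}))"
  shows "\<exists>e::'a. e \<noteq> 0 \<and>
    (\<forall>g::'a \<Rightarrow> real. (\<Sum>x\<in>UNIV. g (x^2)) + (\<Sum>x\<in>UNIV. g (e * x^2)) = 2 * (\<Sum>y\<in>UNIV. g y))"
proof -
  define R where "R = (UNIV - {0} :: 'a set)"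
  define S where "S = (\<lambda>x. x^2) ` R"
  have two: "(2::'a) \<noteq> 0" by (rule two_neq_zero_if_odd_card) fact
  have SR: "S \<subseteq> R" by (auto simp: S_def R_def)
  have fibre: "card {x \<in> R. x^2 = s} = 2" if "s \<in> S" for s
  proof -
    obtain y where y: "y \<noteq> 0" "s = y^2" using \<open>s \<in> S\<close> by (auto simp: S_def R_def)
    have "{x \<in> R. x^2 = s} = {y, -y}"
      using y by (auto simp: R_def power2_eq_iff)
    moreover have "y \<noteq> -y"
      using y two by (metis add.right_inverse mult_2 mult_eq_0_iff)
    ultimately show ?thesis by simp
  qed
  have sumS: "(\<Sum>x\<in>R. g (x^2)) = 2 * (\<Sum>s\<in>S. g s)" for g :: "'a \<Rightarrow> real"
  proof -
    have "(\<Sum>x\<in>R. g (x^2)) = (\<Sum>s\<in>S. \<Sum>x\<in>{x \<in> R. x^2 = s}. g (x^2))"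
      by (rule sum.group [symmetric]) (auto simp: S_def)
    also have "\<dots> = (\<Sum>s\<in>S. 2 * g s)"
      using fibre by (intro sum.cong refl) simp
    finally show ?thesis by (simp add: sum_distrib_left)
  qed
  have cS: "card R = 2 * card S"
    using sumS[of "\<lambda>_. 1"] by simp
  have "R \<noteq> {}" unfolding R_def by (metis DiffI UNIV_I empty_iff singletonD zero_neq_one)
  then have "card R > 0" by (simp add: card_gt_0_iff)
  with cS have "card S < card R" by simp
  then have "S \<noteq> R" by auto
  then obtain e where e: "e \<in> R" "e \<notin> S" using SR by blast
  have e0: "e \<noteq> 0" using e by (auto simp: R_def)
  have disj: "S \<inter> (*) e ` S = {}"
  proof (rule ccontr)
    assume "S \<inter> (*) e ` S \<noteq> {}"
    then obtain x y where xy: "x \<noteq> 0" "y \<noteq> 0" "x^2 = e * y^2" by (auto simp: S_def R_def)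
    then have "e = (x / y)^2" by (simp add: power_divide field_simps)
    then have "e \<in> S" using xy by (auto simp: S_def R_def)
    with e show False by simp
  qed
  have inj: "inj_on ((*) e) S" using e0 by (auto simp: inj_on_def)
  have un: "S \<union> (*) e ` S = R"
  proof (rule card_subset_eq)
    show "S \<union> (*) e ` S \<subseteq> R" using SR e0 by (auto simp: R_def)
    show "card (S \<union> (*) e ` S) = card R"
      using disj cS by (simp add: card_Un_disjoint card_image[OF inj])
  qed simp
  have ins: "(\<Sum>x\<in>UNIV. h x) = h 0 + (\<Sum>x\<in>R. h x)" for h :: "'a \<Rightarrow> real"
    unfolding R_def by (rule sum.remove) auto
  show ?thesis
  proof (intro exI[of _ e] conjI allI e0)
    fix g :: "'a \<Rightarrow> real"
    have "(\<Sum>x\<in>R. g (x^2)) + (\<Sum>x\<in>R. g (e * x^2)) = 2 * ((\<Sum>s\<in>S. g s) + (\<Sum>s\<in>(*) e ` S. g s))"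
      using sumS[of g] sumS[of "\<lambda>s. g (e * s)"] by (simp add: sum.reindex[OF inj])
    also have "\<dots> = 2 * (\<Sum>y\<in>R. g y)"
      using disj un by (simp flip: sum.union_disjoint)
    finally show "(\<Sum>x\<in>UNIV. g (x^2)) + (\<Sum>x\<in>UNIV. g (e * x^2)) = 2 * (\<Sum>y\<in>UNIV. g y)"
      by (simp add: ins)
  qed
qed

text \<open>The weight \<open>wt c\<close> is the sum over all nontrivial additive characters of their values at \<open>c\<close>.\<close>

definition wt :: "'a::{field,finite} \<Rightarrow> real" where
  "wt c = (if c = 0 then real CARD('a) - 1 else - 1)"

lemma wt_0 [simp]: "wt (0::'a::{field,finite}) = real CARD('a) - 1"
  by (simp add: wt_def)

lemma wt_uminus [simp]: "wt (- c) = wt c"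
  by (simp add: wt_def)

lemma sum_wt: "(\<Sum>c\<in>UNIV. wt (c::'a::{field,finite})) = 0"
  by (subst sum.remove[of UNIV 0]) (auto simp: wt_def card_Diff_subset sum_constant algebra_simps of_nat_diff Suc_leI)

lemma sum_wt_affine:
  fixes b :: "'a::{field,finite}"
  assumes "b \<noteq> 0"
  shows "(\<Sum>x\<in>UNIV. wt (c + x * b)) = 0"
proof -
  have "(\<Sum>x\<in>UNIV. wt (c + x * b)) = (\<Sum>y::'a\<in>UNIV. wt y)"
    by (rule sum.reindex_bij_witness[of _ "\<lambda>y. (y - c) / b" "\<lambda>x. c + x * b"]) (use assms in auto)
  then show ?thesis by (simp add: sum_wt)
qed

text \<open>Substitute for the orthogonality of an additive character: a sum of weights vanishes as soon
  as some translation action moves the argument affinely with a nonzero invariant slope.\<close>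

lemma sum_wt_zero:
  fixes f :: "'b \<Rightarrow> 'a::{field,finite}"
  assumes closed: "\<And>b x. x \<in> S \<Longrightarrow> t b x \<in> S"
    and inv: "\<And>b x. x \<in> S \<Longrightarrow> t (- b) (t b x) = x"
    and f: "\<And>b x. x \<in> S \<Longrightarrow> f (t b x) = f x + b * l"
    and l: "l \<noteq> 0"
  shows "(\<Sum>x\<in>S. wt (f x)) = 0"
proof -
  have tr: "(\<Sum>x\<in>S. wt (f (t b x))) = (\<Sum>x\<in>S. wt (f x))" for b
    by (rule sum.reindex_bij_witness[of _ "t (- b)" "t b"]) (use closed inv inv[of _ "- b"] in auto)
  have "real CARD('a) * (\<Sum>x\<in>S. wt (f x)) = (\<Sum>b::'a\<in>UNIV. \<Sum>x\<in>S. wt (f (t b x)))"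
    by (simp add: tr)
  also have "\<dots> = (\<Sum>x\<in>S. \<Sum>b::'a\<in>UNIV. wt (f x + b * l))"
    by (subst sum.swap) (simp add: f)
  also have "\<dots> = 0" using l by (simp add: sum_wt_affine)
  finally show ?thesis by simp
qed

text \<open>Counterpart of the sign change of a Gauss sum. For one variable the twisted and
  untwisted sums add up to twice a sum over an affine line, which is 0; so each variable contributes
  a factor -1, the others being absorbed into \<open>c\<close>.\<close>

lemma sum_wt_diag_twist:
  fixes e :: "'a::{field,finite}"
  assumes e: "\<And>g :: 'a \<Rightarrow> real. (\<Sum>x\<in>UNIV. g (x^2)) + (\<Sum>x\<in>UNIV. g (e * x^2)) = 2 * (\<Sum>y\<in>UNIV. g y)"
    and I: "finite I" and a: "\<And>i. i \<in> I \<Longrightarrow> a i \<noteq> 0"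
  shows "(\<Sum>u\<in>I \<rightarrow>\<^sub>E UNIV. wt (c + e * (\<Sum>i\<in>I. a i * (u i)^2))) =
         (- 1) ^ card I * (\<Sum>u\<in>I \<rightarrow>\<^sub>E UNIV. wt (c + (\<Sum>i\<in>I. a i * (u i)^2)))"
  using I a
proof (induction I arbitrary: c)
  case empty
  then show ?case by simp
next
  case (insert k I)
  have split: "(\<Sum>u\<in>insert k I \<rightarrow>\<^sub>E UNIV. G u) = (\<Sum>y\<in>UNIV. \<Sum>u\<in>I \<rightarrow>\<^sub>E UNIV. G (u(k := y)))"
    for G :: "('b \<Rightarrow> 'a) \<Rightarrow> real"
    using insert.hyps
    by (subst PiE_insert_eq, subst sum.reindex)
       (auto simp: sum.cartesian_product case_prod_beta intro!: inj_combinator)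
  have upd: "(\<Sum>i\<in>insert k I. a i * ((u(k := y)) i)^2) = a k * y^2 + (\<Sum>i\<in>I. a i * (u i)^2)" for u y
    using insert.hyps by (auto intro!: sum.cong)
  have one: "(\<Sum>y\<in>UNIV. wt (d + e * (a k * y^2))) = - (\<Sum>y\<in>UNIV. wt (d + a k * y^2))" for d
  proof -
    have "(\<Sum>y\<in>UNIV. wt (d + a k * y^2)) + (\<Sum>y\<in>UNIV. wt (d + a k * (e * y^2))) = 2 * (\<Sum>y\<in>UNIV. wt (d + a k * y))"
      by (rule e)
    also have "\<dots> = 0" using sum_wt_affine[of "a k" d] insert.prems by (simp add: mult.commute)
    finally show ?thesis by (simp add: algebra_simps)
  qed
  have "(\<Sum>u\<in>insert k I \<rightarrow>\<^sub>E UNIV. wt (c + e * (\<Sum>i\<in>insert k I. a i * (u i)^2)))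
      = (\<Sum>y\<in>UNIV. \<Sum>u\<in>I \<rightarrow>\<^sub>E UNIV. wt ((c + e * (a k * y^2)) + e * (\<Sum>i\<in>I. a i * (u i)^2)))"
    unfolding split upd by (simp add: algebra_simps)
  also have "\<dots> = (\<Sum>y\<in>UNIV. (- 1) ^ card I * (\<Sum>u\<in>I \<rightarrow>\<^sub>E UNIV. wt ((c + e * (a k * y^2)) + (\<Sum>i\<in>I. a i * (u i)^2))))"
    using insert.prems by (intro sum.cong refl insert.IH) auto
  also have "\<dots> = (- 1) ^ card I * (\<Sum>u\<in>I \<rightarrow>\<^sub>E UNIV. \<Sum>y\<in>UNIV. wt ((c + (\<Sum>i\<in>I. a i * (u i)^2)) + e * (a k * y^2)))"
    unfolding sum_distrib_left[symmetric] by (subst sum.swap) (simp add: algebra_simps)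
  also have "\<dots> = (- 1) ^ card (insert k I) * (\<Sum>u\<in>I \<rightarrow>\<^sub>E UNIV. \<Sum>y\<in>UNIV. wt ((c + (\<Sum>i\<in>I. a i * (u i)^2)) + a k * y^2))"
    using insert.hyps by (simp add: one sum_negf)
  also have "\<dots> = (- 1) ^ card (insert k I) * (\<Sum>y\<in>UNIV. \<Sum>u\<in>I \<rightarrow>\<^sub>E UNIV. wt (c + (a k * y^2 + (\<Sum>i\<in>I. a i * (u i)^2))))"
    by (subst sum.swap) (simp add: algebra_simps)
  finally show ?case unfolding split upd .
qed

text \<open>With \<open>e\<close> from \<open>nonsquare_cover\<close>, replacing \<open>v\<close> by
  \<open>e * v\<close> permutes the nonzero scalars but multiplies each inner sum by
  \<open>(- 1) ^ n = - 1\<close>, so the total is its own negative.\<close>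

lemma sum_wt_scaled_odd:
  fixes a :: "nat \<Rightarrow> 'a::{field,finite}"
  assumes q: "odd (CARD('a))" and n: "odd n" and a: "\<forall>i<n. a i \<noteq> 0"
  shows "(\<Sum>v\<in>UNIV - {0}. \<Sum>u\<in>{..<n} \<rightarrow>\<^sub>E UNIV. wt (c + v * (\<Sum>i<n. a i * (u i)^2))) = 0"
    (is "?S = 0")
proof -
  obtain e :: 'a where e0: "e \<noteq> 0"
    and e: "\<And>g :: 'a \<Rightarrow> real. (\<Sum>x\<in>UNIV. g (x^2)) + (\<Sum>x\<in>UNIV. g (e * x^2)) = 2 * (\<Sum>y\<in>UNIV. g y)"
    using nonsquare_cover[OF q] by blast
  have "?S = (\<Sum>v\<in>UNIV - {0}. \<Sum>u\<in>{..<n} \<rightarrow>\<^sub>E UNIV. wt (c + (e * v) * (\<Sum>i<n. a i * (u i)^2)))"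
    by (rule sum.reindex_bij_witness[of _ "\<lambda>v. e * v" "\<lambda>v. v / e"]) (use e0 in auto)
  also have "\<dots> = (\<Sum>v\<in>UNIV - {0}. \<Sum>u\<in>{..<n} \<rightarrow>\<^sub>E UNIV. wt (c + e * (\<Sum>i<n. (v * a i) * (u i)^2)))"
    by (simp add: sum_distrib_left mult.assoc)
  also have "\<dots> = (\<Sum>v\<in>UNIV - {0}. (- 1) ^ card {..<n} *
      (\<Sum>u\<in>{..<n} \<rightarrow>\<^sub>E UNIV. wt (c + (\<Sum>i<n. (v * a i) * (u i)^2))))"
    using a by (intro sum.cong refl sum_wt_diag_twist e) auto
  also have "\<dots> = - ?S"
    using n by (simp add: sum_distrib_left sum_negf mult.assoc)
  finally show ?thesis by simp
qed

section \<open>Truncated power series\<close>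

definition fps_below :: "nat \<Rightarrow> 'a::zero fps set" where
  "fps_below P = {f. \<forall>l\<ge>P. f $ l = 0}"

lemma fps_belowD: "f \<in> fps_below P \<Longrightarrow> P \<le> l \<Longrightarrow> f $ l = 0"
  by (simp add: fps_below_def)

lemma zero_in_fps_below [simp]: "0 \<in> fps_below P"
  by (simp add: fps_below_def)

lemma fps_below_0 [simp]: "fps_below 0 = {0}"
  by (auto simp: fps_below_def fps_eq_iff)

lemma cutoff_in_fps_below [simp]: "fps_cutoff P f \<in> fps_below P"
  by (simp add: fps_below_def)

lemma cutoff_fps_below [simp]: "f \<in> fps_below P \<Longrightarrow> fps_cutoff P f = f"
  by (simp add: fps_below_def fps_eq_iff)

lemma bij_betw_fps_below:
  "bij_betw (\<lambda>f. restrict (fps_nth f) {..<P}) (fps_below P :: 'a::zero fps set) ({..<P} \<rightarrow>\<^sub>E UNIV)"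
proof (rule bij_betwI[where g = "\<lambda>h. Abs_fps (\<lambda>l. if l < P then h l else 0)"])
  show "restrict (fps_nth (Abs_fps (\<lambda>l. if l < P then h l else 0))) {..<P} = h"
    if "h \<in> {..<P} \<rightarrow>\<^sub>E UNIV" for h :: "nat \<Rightarrow> 'a"
    using that by (auto simp: fun_eq_iff PiE_def extensional_def)
qed (auto simp: fps_below_def fps_eq_iff)

lemma finite_fps_below [simp]: "finite (fps_below P :: 'a::{zero,finite} fps set)"
  using bij_betw_finite[OF bij_betw_fps_below[where 'a = 'a and P = P]] by (simp add: finite_PiE)

lemma card_fps_below [simp]: "card (fps_below P :: 'a::{zero,finite} fps set) = CARD('a) ^ P"
  using bij_betw_same_card[OF bij_betw_fps_below[where 'a = 'a and P = P]] by (simp add: card_PiE)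

lemma fps_mult_below_nth_eq_0:
  fixes f g :: "'a::semiring_0 fps"
  assumes "f \<in> fps_below l" "g \<in> fps_below m" "l + m \<le> Suc d"
  shows "(f * g) $ d = 0"
  unfolding fps_mult_nth
proof (intro sum.neutral ballI)
  fix i assume "i \<in> {0..d}"
  show "f $ i * g $ (d - i) = 0"
  proof (cases "l \<le> i")
    case True
    then show ?thesis using assms by (simp add: fps_belowD)
  next
    case False
    then have "m \<le> d - i" using assms by linarith
    then show ?thesis using assms by (simp add: fps_belowD)
  qed
qed

lemma fps_below_append:
  fixes f g :: "'a::comm_ring_1 fps"
  assumes "f \<in> fps_below l" "g \<in> fps_below m"
  shows "f + fps_X ^ l * g \<in> fps_below (l + m)"
    and "fps_cutoff l (f + fps_X ^ l * g) = f"
    and "fps_shift l (f + fps_X ^ l * g) = g"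
  using assms by (auto simp: fps_below_def fps_eq_iff fps_X_power_mult_nth)

lemma shift_in_fps_below: "h \<in> fps_below (l + m) \<Longrightarrow> fps_shift l h \<in> fps_below m"
  by (simp add: fps_below_def)

lemma sum_fps_below_append:
  fixes G :: "'a::comm_ring_1 fps \<Rightarrow> 'b::comm_monoid_add"
  shows "(\<Sum>h\<in>fps_below (l + m). G h) = (\<Sum>f\<in>fps_below l. \<Sum>g\<in>fps_below m. G (f + fps_X ^ l * g))"
proof -
  have "(\<Sum>h\<in>fps_below (l + m). G h) = (\<Sum>(f, g)\<in>fps_below l \<times> fps_below m. G (f + fps_X ^ l * g))"
    by (rule sum.reindex_bij_witness[of _ "\<lambda>(f, g). f + fps_X ^ l * g" "\<lambda>h. (fps_cutoff l h, fps_shift l h)"])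
       (auto simp: fps_below_append shift_in_fps_below add.commute[of "fps_cutoff _ _"] fps_shift_cutoff')
  then show ?thesis by (simp add: sum.cartesian_product)
qed

section \<open>Vectors of truncated series and Hankel forms on them\<close>

definition vecs :: "nat \<Rightarrow> nat \<Rightarrow> (nat \<Rightarrow> 'a::zero fps) set" where
  "vecs n P = {..<n} \<rightarrow>\<^sub>E fps_below P"

lemma vecsD: "x \<in> vecs n P \<Longrightarrow> i < n \<Longrightarrow> x i \<in> fps_below P"
  by (auto simp: vecs_def)

lemma finite_vecs [simp]: "finite (vecs n P :: (nat \<Rightarrow> 'a::{zero,finite} fps) set)"
  by (simp add: vecs_def finite_PiE)

lemma card_vecs: "card (vecs n P :: (nat \<Rightarrow> 'a::{zero,finite} fps) set) = CARD('a) ^ (n * P)"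
  by (simp add: vecs_def card_PiE power_mult mult.commute)

text \<open>Members of \<open>vecs n P\<close> are fixed outside \<open>{..<n}\<close>, unlike the
  assembled vector; hence \<open>G\<close> is required to depend on the first \<open>n\<close>
  coordinates only.\<close>

lemma sum_vecs_append:
  fixes G :: "(nat \<Rightarrow> 'a::comm_ring_1 fps) \<Rightarrow> 'b::comm_monoid_add"
  assumes G: "\<And>x y. (\<And>i. i < n \<Longrightarrow> x i = y i) \<Longrightarrow> G x = G y"
  shows "(\<Sum>h\<in>vecs n (l + m). G h) = (\<Sum>f\<in>vecs n l. \<Sum>g\<in>vecs n m. G (\<lambda>i. f i + fps_X ^ l * g i))"
proof -
  have "(\<Sum>h\<in>vecs n (l + m). G h) = (\<Sum>(f, g)\<in>vecs n l \<times> vecs n m. G (\<lambda>i. f i + fps_X ^ l * g i))"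
  proof (rule sum.reindex_bij_witness[of _ "\<lambda>(f, g). \<lambda>i\<in>{..<n}. f i + fps_X ^ l * g i"
        "\<lambda>h. (\<lambda>i\<in>{..<n}. fps_cutoff l (h i), \<lambda>i\<in>{..<n}. fps_shift l (h i))"], goal_cases)
    case (1 h)
    then show ?case
      by (auto simp: fun_eq_iff vecs_def PiE_def extensional_def add.commute[of "fps_cutoff _ _"] fps_shift_cutoff')
  next
    case (2 h)
    then show ?case by (auto simp: vecs_def PiE_def Pi_def shift_in_fps_below)
  next
    case (3 p)
    then show ?case
      by (auto simp: fun_eq_iff vecs_def PiE_def Pi_def extensional_def fps_below_append[of _ l _ m])
  next
    case (4 p)
    then show ?case by (auto simp: vecs_def PiE_def Pi_def fps_below_append)
  next
    case (5 h)
    then show ?case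
      by (auto intro!: G simp: add.commute[of "fps_cutoff _ _"] fps_shift_cutoff')
  qed
  then show ?thesis by (simp add: sum.cartesian_product)
qed

lemma sum_vecs_map:
  fixes T :: "'a::zero fps \<Rightarrow> 'a fps"
  assumes bij: "bij_betw T (fps_below P) (fps_below R)"
    and G: "\<And>x y. (\<And>i. i < n \<Longrightarrow> x i = y i) \<Longrightarrow> G x = G y"
  shows "(\<Sum>x\<in>vecs n R. G x) = (\<Sum>y\<in>vecs n P. G (\<lambda>i. T (y i)))"
proof -
  let ?T' = "the_inv_into (fps_below P) T"
  have T: "T f \<in> fps_below R" "?T' (T f) = f" if "f \<in> fps_below P" for f
    using bij that by (auto simp: bij_betw_def the_inv_into_f_f)
  have T': "?T' f \<in> fps_below P" "T (?T' f) = f" if "f \<in> fps_below R" for f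
    using bij that bij_betw_the_inv_into[OF bij] by (auto simp: bij_betw_def f_the_inv_into_f)
  show ?thesis
  proof (rule sum.reindex_bij_witness[of _ "\<lambda>y. \<lambda>i\<in>{..<n}. T (y i)" "\<lambda>x. \<lambda>i\<in>{..<n}. ?T' (x i)"])
    fix x :: "nat \<Rightarrow> 'a fps" assume "x \<in> vecs n R"
    then show "(\<lambda>i\<in>{..<n}. T ((\<lambda>i\<in>{..<n}. ?T' (x i)) i)) = x"
      by (auto simp: vecs_def PiE_def Pi_def extensional_def fun_eq_iff T')
    show "(\<lambda>i\<in>{..<n}. ?T' (x i)) \<in> vecs n P"
      using \<open>x \<in> vecs n R\<close> by (auto simp: vecs_def PiE_def Pi_def T')
    show "G (\<lambda>i. T ((\<lambda>i\<in>{..<n}. ?T' (x i)) i)) = G x"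
      using \<open>x \<in> vecs n R\<close> by (intro G) (auto simp: vecs_def PiE_def Pi_def T')
  next
    fix y :: "nat \<Rightarrow> 'a fps" assume "y \<in> vecs n P"
    then show "(\<lambda>i\<in>{..<n}. ?T' ((\<lambda>i\<in>{..<n}. T (y i)) i)) = y" "(\<lambda>i\<in>{..<n}. T (y i)) \<in> vecs n R"
      by (auto simp: vecs_def PiE_def Pi_def extensional_def fun_eq_iff T)
  qed
qed

text \<open>In one variable, \<open>(A * x^2) $ D\<close> is the sum of
  \<open>A $ (D - j - k) * x $ j * x $ k\<close> over \<open>j + k \<le> D\<close>, a quadratic form
  with Hankel matrix.\<close>

definition qform :: "nat \<Rightarrow> (nat \<Rightarrow> 'a::comm_ring_1) \<Rightarrow> 'a fps \<Rightarrow> nat \<Rightarrow> (nat \<Rightarrow> 'a fps) \<Rightarrow> 'a" where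
  "qform n a A D x = (\<Sum>i<n. a i * (A * x i ^ 2) $ D)"

lemma qform_cong: "(\<And>i. i < n \<Longrightarrow> x i = y i) \<Longrightarrow> qform n a A D x = qform n a A D y"
  by (simp add: qform_def)

section \<open>Anti-triangular blocks and inversion of power series\<close>

lemma fps_double_nth: "(2 * f) $ k = 2 * (f :: 'a::comm_ring_1 fps) $ k"
  by (simp add: numeral_fps_const)

lemma qform_diff_single:
  assumes "i < n" "\<And>k. k < n \<Longrightarrow> k \<noteq> i \<Longrightarrow> x k = y k"
  shows "qform n a A D x = qform n a A D y + a i * ((A * x i ^ 2) $ D - (A * y i ^ 2) $ D)"
proof -
  have "(\<Sum>k\<in>{..<n} - {i}. a k * (A * x k ^ 2) $ D) = (\<Sum>k\<in>{..<n} - {i}. a k * (A * y k ^ 2) $ D)"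
    using assms by (intro sum.cong) auto
  then show ?thesis
    using assms(1) by (simp add: qform_def sum.remove[of "{..<n}" i] algebra_simps)
qed

text \<open>A nonzero \<open>p i\<close> pairs nontrivially with the multiples of
  \<open>fps_X ^ j\<close>: changing one coefficient of \<open>s i\<close> moves the form along an
  affine line, so the weights cancel by \<open>sum_wt_zero\<close>.\<close>

lemma sum_wt_qform_append_eq_0:
  fixes a :: "nat \<Rightarrow> 'a::{field,finite}"
  assumes q: "odd (CARD('a))" and i: "i < n" "a i \<noteq> 0" and V: "V $ 0 \<noteq> 0"
    and p: "p \<in> vecs n j" "p i \<noteq> 0" and k: "Suc k = j + m" "j \<le> m" "m \<le> Suc j"
  shows "(\<Sum>s\<in>vecs n m. wt (c + qform n a V k (\<lambda>i. p i + fps_X ^ j * s i))) = 0"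
proof -
  define r0 where "r0 = subdegree (p i)"
  \<comment> \<open>Chosen so that \<open>j + r + r0 = k\<close>: the lowest term of
    \<open>p i\<close> then meets the coefficient \<open>k\<close>.\<close>
  define r where "r = k - j - r0"
  have r0: "r0 < j"
    using p i unfolding r0_def by (metis fps_belowD nth_subdegree_nonzero vecsD not_less)
  have r: "r < m" "Suc k \<le> 2 * j + r" "j + r + r0 = k"
    using r0 k by (auto simp: r_def)
  have pr: "(V * p i) $ r0 = V $ 0 * p i $ r0"
    unfolding r0_def using V fps_mult_nth_outside_subdegrees
    by (metis add.commute add_0 nth_subdegree_mult subdegree_eq_0)
  show ?thesis
  proof (rule sum_wt_zero[where t = "\<lambda>b s. s(i := s i + fps_const b * fps_X ^ r)"
        and l = "a i * 2 * (V $ 0 * p i $ r0)"])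
    show "s(i := s i + fps_const b * fps_X ^ r) \<in> vecs n m" if "s \<in> vecs n m" for b s
      using that i r(1) by (auto simp: vecs_def PiE_def Pi_def extensional_def fps_below_def)
    show "a i * 2 * (V $ 0 * p i $ r0) \<noteq> 0"
      using i V p two_neq_zero_if_odd_card[OF q] by (simp add: r0_def)
    fix b :: 'a and s :: "nat \<Rightarrow> 'a fps"
    show "(s(i := s i + fps_const b * fps_X ^ r))
        (i := (s(i := s i + fps_const b * fps_X ^ r)) i + fps_const (- b) * fps_X ^ r) = s"
      by (simp add: fun_eq_iff fps_eq_iff)
    let ?S = "p i + fps_X ^ j * s i" and ?B = "fps_const b"
    \<comment> \<open>Of the new terms only the one linear in \<open>b\<close> and \<open>p\<close>
      reaches the coefficient \<open>k\<close>; the others are divisible by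
      \<open>fps_X ^ (2 * j + r)\<close>, and \<open>2 * j + r > k\<close>.\<close>
    have "V * (p + x * (s + b * y))^2 =
        V * (p + x * s)^2 + (x * y) * (b * (2 * (V * p))) + (x^2 * y) * (b * (2 * V * s) + b^2 * V * y)"
      for p x s b y :: "'a fps"
      by (simp add: power2_eq_square algebra_simps)
    from this[of "p i" "fps_X ^ j" "s i" ?B "fps_X ^ r"]
    have "V * (p i + fps_X ^ j * (s i + ?B * fps_X ^ r))^2 =
       V * ?S^2 + fps_X ^ (j + r) * (?B * (2 * (V * p i))) +
       fps_X ^ (2 * j + r) * (?B * (2 * V * s i) + ?B^2 * V * fps_X ^ r)"
      by (simp only: power_add power_mult mult.commute[of 2 j])
    then have "(V * (p i + fps_X ^ j * (s i + ?B * fps_X ^ r))^2) $ k =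
       (V * ?S^2) $ k + (fps_X ^ (j + r) * (?B * (2 * (V * p i)))) $ k"
      using r by (simp add: fps_X_power_mult_nth)
    also have "(fps_X ^ (j + r) * (?B * (2 * (V * p i)))) $ k = b * (2 * (V * p i) $ r0)"
    proof -
      have "k - (j + r) = r0" "\<not> k < j + r" using r by simp_all
      then show ?thesis by (simp add: fps_X_power_mult_nth fps_double_nth)
    qed
    finally show "c + qform n a V k (\<lambda>l. p l + fps_X ^ j * (s(i := s i + ?B * fps_X ^ r)) l) =
        c + qform n a V k (\<lambda>l. p l + fps_X ^ j * s l) + b * (a i * 2 * (V $ 0 * p i $ r0))"
      using i(1) pr
      by (subst qform_diff_single[where i = i and y = "\<lambda>l. p l + fps_X ^ j * s l"])
         (auto simp: algebra_simps)
  qed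
qed

lemma fps_X_power_mult_square: "(fps_X ^ j * f)^2 = fps_X ^ (2 * j) * (f :: 'a::comm_ring_1 fps)^2"
  by (simp only: power_mult_distrib power_mult mult.commute[of 2 j])

text \<open>The subspace \<open>fps_X ^ j * _\<close> is totally isotropic (up to one middle coordinate if \<open>m = j + 1\<close>),
  so only vectors orthogonal to it contribute.\<close>

lemma sum_wt_qform_isotropic:
  fixes a :: "nat \<Rightarrow> 'a::{field,finite}"
  assumes q: "odd (CARD('a))" and a: "\<forall>i<n. a i \<noteq> 0" and V: "V $ 0 \<noteq> 0"
    and k: "Suc k = j + m" "j \<le> m" "m \<le> Suc j"
  shows "(\<Sum>x\<in>vecs n (Suc k). wt (c + qform n a V k x)) =
         (\<Sum>s\<in>vecs n m. wt (c + qform n a V k (\<lambda>i. fps_X ^ j * s i)))"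
proof -
  let ?z = "\<lambda>i\<in>{..<n}. 0 :: 'a fps"
  have z: "?z \<in> vecs n j" by (auto simp: vecs_def)
  have zero: "(\<Sum>s\<in>vecs n m. wt (c + qform n a V k (\<lambda>i. p i + fps_X ^ j * s i))) = 0"
    if p: "p \<in> vecs n j" "p \<noteq> ?z" for p
  proof -
    obtain i where "i < n" "p i \<noteq> 0"
      using p by (auto simp: vecs_def PiE_def extensional_def fun_eq_iff split: if_splits)
    then show ?thesis using a by (intro sum_wt_qform_append_eq_0[OF q _ _ V p(1) _ k]) auto
  qed
  have "(\<Sum>x\<in>vecs n (Suc k). wt (c + qform n a V k x)) =
      (\<Sum>p\<in>vecs n j. \<Sum>s\<in>vecs n m. wt (c + qform n a V k (\<lambda>i. p i + fps_X ^ j * s i)))"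
    unfolding k(1) by (rule sum_vecs_append) (simp cong: qform_cong)
  also have "\<dots> = (\<Sum>p\<in>{?z}. \<Sum>s\<in>vecs n m. wt (c + qform n a V k (\<lambda>i. p i + fps_X ^ j * s i)))"
    using z zero by (intro sum.mono_neutral_right) auto
  also have "\<dots> = (\<Sum>s\<in>vecs n m. wt (c + qform n a V k (\<lambda>i. fps_X ^ j * s i)))"
    by (simp cong: qform_cong)
  finally show ?thesis .
qed

text \<open>The isotropic subspace now has half the dimension, so the block is hyperbolic: the form
  vanishes on the whole subspace and each of its vectors contributes \<open>wt c\<close>.\<close>

lemma sum_wt_qform_even:
  fixes a :: "nat \<Rightarrow> 'a::{field,finite}"
  assumes q: "odd (CARD('a))" and a: "\<forall>i<n. a i \<noteq> 0" and V: "V $ 0 \<noteq> 0"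
    and k: "Suc k = 2 * j"
  shows "(\<Sum>x\<in>vecs n (2 * j). wt (c + qform n a V k x)) = real CARD('a) ^ (n * j) * wt c"
proof -
  have "(V * (fps_X ^ j * f)^2) $ k = 0" for f
  proof -
    have eq: "V * (fps_X ^ j * f)^2 = fps_X ^ (2 * j) * (V * f^2)"
      by (simp only: fps_X_power_mult_square mult.left_commute)
    show ?thesis unfolding eq using k by (simp add: fps_X_power_mult_nth)
  qed
  then show ?thesis
    using sum_wt_qform_isotropic[OF q a V, of k j j c] k
    by (simp add: qform_def card_vecs mult_2)
qed

text \<open>Among the \<open>j + 1\<close> upper coefficients of each variable only the middle one,
  \<open>s i $ 0\<close>, is visible, with factor \<open>V $ 0\<close>; the other \<open>j\<close>
  are free.\<close>

lemma sum_wt_qform_odd: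
  fixes a :: "nat \<Rightarrow> 'a::{field,finite}"
  assumes q: "odd (CARD('a))" and a: "\<forall>i<n. a i \<noteq> 0" and V: "V $ 0 \<noteq> 0"
  shows "(\<Sum>x\<in>vecs n (Suc (2 * j)). wt (c + qform n a V (2 * j) x)) =
     real CARD('a) ^ (n * j) * (\<Sum>u\<in>{..<n} \<rightarrow>\<^sub>E UNIV. wt (c + V $ 0 * (\<Sum>i<n. a i * (u i)^2)))"
proof -
  define w where "w = (\<lambda>s :: nat \<Rightarrow> 'a fps. wt (c + V $ 0 * (\<Sum>i<n. a i * (s i $ 0)^2)))"
  have coeff: "(V * (fps_X ^ j * f)^2) $ (2 * j) = V $ 0 * (f $ 0)^2" for f
  proof -
    have eq: "V * (fps_X ^ j * f)^2 = fps_X ^ (2 * j) * (V * f^2)"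
      by (simp only: fps_X_power_mult_square mult.left_commute)
    show ?thesis unfolding eq by (simp add: fps_X_power_mult_nth power2_eq_square)
  qed
  have w_cong: "w x = w y" if "\<And>i. i < n \<Longrightarrow> x i = y i" for x y
    using that by (simp add: w_def)
  have "(\<Sum>x\<in>vecs n (Suc (2 * j)). wt (c + qform n a V (2 * j) x)) = (\<Sum>s\<in>vecs n (1 + j). w s)"
    using sum_wt_qform_isotropic[OF q a V, of "2 * j" j "Suc j" c]
    by (simp add: qform_def coeff w_def sum_distrib_left mult.left_commute)
  also have "\<dots> = real CARD('a) ^ (n * j) * (\<Sum>s\<in>vecs n 1. w s)"
    by (subst sum_vecs_append[OF w_cong]) (auto simp: w_def card_vecs sum_distrib_left)
  also have "(\<Sum>s\<in>vecs n 1. w s) = (\<Sum>u\<in>{..<n} \<rightarrow>\<^sub>E UNIV. wt (c + V $ 0 * (\<Sum>i<n. a i * (u i)^2)))"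
    by (rule sum.reindex_bij_witness[of _ "\<lambda>u. \<lambda>i\<in>{..<n}. fps_const (u i)" "\<lambda>s. \<lambda>i\<in>{..<n}. s i $ 0"])
       (auto simp: vecs_def PiE_def Pi_def extensional_def fps_below_def fun_eq_iff fps_eq_iff w_def)
  finally show ?thesis .
qed

section \<open>Substitution by a unit series modulo a power of the variable\<close>

lemma bij_betw_cutoff_mult:
  fixes V :: "'a::field fps"
  assumes V: "V $ 0 \<noteq> 0"
  shows "bij_betw (\<lambda>y. fps_cutoff P (V * y)) (fps_below P) (fps_below P)"
proof (rule bij_betwI[where g = "\<lambda>x. fps_cutoff P (inverse V * x)"])
  have *: "fps_cutoff P (A * fps_cutoff P (B * y)) = y" if "A * B = 1" "y \<in> fps_below P" for A B y :: "'a fps"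
  proof -
    have "fps_cutoff P (A * fps_cutoff P (B * y)) = fps_cutoff P (A * (B * y))"
      by (simp add: fps_cutoff_eq_fps_cutoff_iff fps_cutoff_right_mult_nth)
    then show ?thesis using that by (simp flip: mult.assoc)
  qed
  show "fps_cutoff P (inverse V * fps_cutoff P (V * x)) = x" if "x \<in> fps_below P" for x
    using that V by (intro *) (simp_all add: inverse_mult_eq_1)
  show "fps_cutoff P (V * fps_cutoff P (inverse V * x)) = x" if "x \<in> fps_below P" for x
    using that V by (intro *) (simp_all add: inverse_mult_eq_1')
qed auto

text \<open>Put \<open>fps_cutoff P (V * y) = V * y - fps_X ^ P * H\<close> and expand the square:
  the term in \<open>H^2\<close> starts at degree \<open>2 * P\<close>, beyond \<open>D\<close>, so
  only the cross term corrects \<open>V * y^2\<close>.\<close>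

lemma inverse_mult_cutoff_square_nth:
  fixes V :: "'a::field fps"
  assumes V: "V $ 0 \<noteq> 0" and D: "Suc D < 2 * P"
  shows "(inverse V * fps_cutoff P (V * y) ^ 2) $ D =
         (V * y^2) $ D - 2 * (y * (V * y - fps_cutoff P (V * y))) $ D"
proof -
  define H where "H = fps_shift P (V * y)"
  have VV: "inverse V * V = 1" using V by (rule inverse_mult_eq_1)
  have c: "fps_cutoff P (V * y) = V * y - fps_X ^ P * H"
    unfolding H_def using fps_shift_cutoff'[of P "V * y"] by (simp add: algebra_simps)
  have "W * (V * y - x * h)^2 = (W * V) * (V * y^2) - 2 * ((W * V) * (y * (x * h))) + x^2 * (W * h^2)"
    for W x h :: "'a fps"
    by (simp add: power2_eq_square algebra_simps)
  from this[of "inverse V" "fps_X ^ P" H]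
  have "inverse V * fps_cutoff P (V * y) ^ 2 =
      V * y^2 - 2 * (y * (fps_X ^ P * H)) + fps_X ^ (2 * P) * (inverse V * H^2)"
    unfolding c VV by (simp only: mult_1_left power_mult mult.commute[of 2 P])
  then show ?thesis
    unfolding c using D by (simp add: fps_X_power_mult_nth fps_double_nth)
qed

text \<open>One step of the Euclidean algorithm: passing from \<open>1 / V\<close> to \<open>V\<close> splits the Hankel form
  orthogonally into an anti-triangular block and a smaller Hankel form.\<close>

lemma inverse_mult_cutoff_square_append_nth:
  fixes V :: "'a::field fps"
  assumes V: "V $ 0 \<noteq> 0" and f: "f \<in> fps_below l"
  shows "(inverse V * fps_cutoff (l + Suc k) (V * (f + fps_X ^ l * g)) ^ 2) $ (2 * l + k) =
         (V * g^2) $ k - (V * f^2) $ (2 * l + k)"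
proof -
  let ?P = "l + Suc k" and ?y = "f + fps_X ^ l * g"
  define H where "H = fps_shift ?P (V * ?y)"
  have c: "V * ?y - fps_cutoff ?P (V * ?y) = fps_X ^ ?P * H"
    unfolding H_def using fps_shift_cutoff'[of ?P "V * ?y"] by (simp add: algebra_simps)
  \<comment> \<open>Since \<open>l + ?P = 2 * l + k + 1\<close> lies just beyond the coefficient
    read off, only the part \<open>f\<close> of \<open>?y\<close> matters in the correction
    term.\<close>
  have yH: "?y * (fps_X ^ ?P * H) = f * (V * ?y - fps_cutoff ?P (V * ?y)) + fps_X ^ (l + ?P) * (g * H)"
    unfolding c by (simp add: algebra_simps power_add)
  have "(?y * (V * ?y - fps_cutoff ?P (V * ?y))) $ (2 * l + k) =
      (f * (V * ?y)) $ (2 * l + k) - (f * fps_cutoff ?P (V * ?y)) $ (2 * l + k)"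
    unfolding yH[folded c] fps_add_nth fps_X_power_mult_nth by (simp add: right_diff_distrib)
  also have "(f * fps_cutoff ?P (V * ?y)) $ (2 * l + k) = 0"
    using f by (rule fps_mult_below_nth_eq_0[where m = ?P]) simp_all
  finally have "(inverse V * fps_cutoff ?P (V * ?y) ^ 2) $ (2 * l + k) = (V * ?y^2 - 2 * (f * (V * ?y))) $ (2 * l + k)"
    using inverse_mult_cutoff_square_nth[OF V, of "2 * l + k" ?P ?y]
    by (simp add: fps_double_nth)
  also have "V * ?y^2 - 2 * (f * (V * ?y)) = fps_X ^ (2 * l) * (V * g^2) - V * f^2"
  proof -
    \<comment> \<open>The terms mixing \<open>f\<close> and \<open>g\<close> cancel: this is the
      orthogonality of the splitting.\<close>
    have "V * (f + x * g)^2 - 2 * (f * (V * (f + x * g))) = x^2 * (V * g^2) - V * f^2" for x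
      by (simp add: power2_eq_square algebra_simps)
    from this[of "fps_X ^ l"] show ?thesis by (simp only: power_mult mult.commute[of 2 l])
  qed
  finally show ?thesis by (simp add: fps_X_power_mult_nth)
qed

section \<open>Sums over Hankel forms\<close>

definition fps_units_below :: "nat \<Rightarrow> 'a::zero fps set" where
  "fps_units_below M = {f \<in> fps_below M. f $ 0 \<noteq> 0}"

lemma finite_fps_units_below [simp]: "finite (fps_units_below M :: 'a::{zero,finite} fps set)"
  by (simp add: fps_units_below_def)

lemma sum_fps_units_below_append:
  fixes G :: "'a::{comm_ring_1,finite} fps \<Rightarrow> 'b::comm_monoid_add"
  assumes "0 < l"
  shows "(\<Sum>h\<in>fps_units_below (l + m). G h) =
         (\<Sum>f\<in>fps_units_below l. \<Sum>g\<in>fps_below m. G (f + fps_X ^ l * g))"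
proof -
  have restr: "(\<Sum>h\<in>fps_units_below P. H h) = (\<Sum>h\<in>fps_below P. if h $ 0 \<noteq> 0 then H h else 0)"
    for P and H :: "'a fps \<Rightarrow> 'b"
    unfolding fps_units_below_def by (rule sum.inter_filter) simp
  have "(\<Sum>h\<in>fps_units_below (l + m). G h) =
      (\<Sum>f\<in>fps_below l. \<Sum>g\<in>fps_below m. if f $ 0 \<noteq> 0 then G (f + fps_X ^ l * g) else 0)"
    unfolding restr sum_fps_below_append using \<open>0 < l\<close> by (simp add: fps_X_power_mult_nth)
  also have "\<dots> = (\<Sum>f\<in>fps_units_below l. \<Sum>g\<in>fps_below m. G (f + fps_X ^ l * g))"
    unfolding restr by (intro sum.cong) auto
  finally show ?thesis .
qed

lemma sum_fps_units_below_1: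
  "(\<Sum>f\<in>fps_units_below 1. G f) = (\<Sum>v\<in>UNIV - {0}. G (fps_const (v :: 'a::zero)))"
  by (rule sum.reindex_bij_witness[of _ fps_const "\<lambda>f. f $ 0"])
     (auto simp: fps_units_below_def fps_below_def fps_eq_iff intro!: arg_cong[where f = G])

lemma card_fps_units_below:
  "real (card (fps_units_below (Suc M) :: 'a::{field,finite} fps set)) = (real CARD('a) - 1) * real CARD('a) ^ M"
proof -
  have "(\<Sum>h\<in>(fps_units_below (1 + M) :: 'a fps set). 1 :: real) = (real CARD('a) - 1) * real CARD('a) ^ M"
    by (subst sum_fps_units_below_append, simp, subst sum_fps_units_below_1)
       (simp add: card_Diff_subset of_nat_diff Suc_leI)
  then show ?thesis by simp
qed

text \<open>Classifies \<open>A\<close> by its order of vanishing; the unit part of a series of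
  order \<open>k\<close> retains \<open>M - k\<close> coefficients.\<close>

lemma sum_fps_below_by_subdegree:
  fixes G :: "'a::{comm_ring_1,finite} fps \<Rightarrow> 'b::comm_monoid_add"
  shows "(\<Sum>A\<in>fps_below M. G A) = G 0 + (\<Sum>k<M. \<Sum>U\<in>fps_units_below (M - k). G (fps_X ^ k * U))"
proof (induction M arbitrary: G)
  case 0
  then show ?case by simp
next
  case (Suc M)
  have "(\<Sum>A\<in>fps_below (Suc M). G A) =
      (\<Sum>A\<in>fps_units_below (Suc M). G A) + (\<Sum>A\<in>{A \<in> fps_below (Suc M). A $ 0 = 0}. G A)"
    unfolding fps_units_below_def
    by (subst sum.union_disjoint[symmetric]) (auto intro!: sum.cong)
  also have "(\<Sum>A\<in>{A \<in> fps_below (Suc M). A $ 0 = 0}. G A) = (\<Sum>A\<in>fps_below M. G (fps_X * A))"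
    by (rule sum.reindex_bij_witness[of _ "\<lambda>A. fps_X * A" "fps_shift 1"])
       (auto simp: fps_below_def fps_eq_iff intro!: arg_cong[where f = G])
  also have "\<dots> = G 0 + (\<Sum>k<M. \<Sum>U\<in>fps_units_below (M - k). G (fps_X ^ Suc k * U))"
    unfolding Suc.IH by (simp add: mult.assoc)
  finally show ?case by (simp add: sum.lessThan_Suc_shift add_ac del: sum.lessThan_Suc power_Suc)
qed

text \<open>Inversion modulo \<open>fps_X ^ M\<close> is an involution on units. It lets the unit
  part of \<open>A\<close> be written as \<open>1 / V\<close>, as the Euclidean step
  requires.\<close>

lemma sum_fps_units_below_inverse:
  fixes G :: "'a::field fps \<Rightarrow> 'b::comm_monoid_add"
  shows "(\<Sum>U\<in>fps_units_below M. G U) = (\<Sum>V\<in>fps_units_below M. G (fps_cutoff M (inverse V)))"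
proof -
  have inv: "fps_cutoff M (inverse V) \<in> fps_units_below M"
       "fps_cutoff M (inverse (fps_cutoff M (inverse V))) = V" if "V \<in> fps_units_below M" for V :: "'a fps"
  proof -
    have V: "V \<in> fps_below M" "V $ 0 \<noteq> 0" "0 < M"
      using that by (auto simp: fps_units_below_def fps_below_def intro: gr0I)
    then show "fps_cutoff M (inverse V) \<in> fps_units_below M"
      by (simp add: fps_units_below_def)
    show "fps_cutoff M (inverse (fps_cutoff M (inverse V))) = V"
      using V by (simp add: fps_cutoff_inverse)
  qed
  show ?thesis
    by (rule sum.reindex_bij_witness[of _ "\<lambda>V. fps_cutoff M (inverse V)" "\<lambda>V. fps_cutoff M (inverse V)"])
       (use inv in auto)
qed

text \<open>The functional \<open>x \<mapsto> (A * x)$(2P-2)\<close> on polynomials of degree at most \<open>2P-2\<close> turns \<open>x \<mapsto> x\<^sup>2\<close>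
  into the quadratic form with Hankel matrix given by the coefficients of \<open>A\<close>.\<close>

definition hankel_sum :: "nat \<Rightarrow> (nat \<Rightarrow> 'a::{field,finite}) \<Rightarrow> nat \<Rightarrow> 'a fps \<Rightarrow> real" where
  "hankel_sum n a P A = (\<Sum>x\<in>vecs n P. wt (qform n a A (2 * P - 2) x))"

lemma qform_coeff_cong:
  assumes "\<And>k. k \<le> D \<Longrightarrow> A $ k = B $ k"
  shows "qform n a A D x = qform n a B D x"
  using assms by (simp add: qform_def fps_mult_nth)

lemma qform_shift: "qform n a (fps_X ^ k * A) (k + D) x = qform n a A D x"
  by (simp add: qform_def mult.assoc fps_X_power_mult_nth)

lemma hankel_sum_shift_cutoff:
  assumes "Suc D = M" "k + D = 2 * P - 2"
  shows "hankel_sum n a P (fps_X ^ k * fps_cutoff M B) = (\<Sum>x\<in>vecs n P. wt (qform n a B D x))"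
  unfolding hankel_sum_def assms(2)[symmetric] qform_shift
  using assms(1) by (intro sum.cong refl arg_cong[where f = wt] qform_coeff_cong) simp

text \<open>Substitute \<open>x = V * y\<close> modulo \<open>fps_X ^ (l + k + 1)\<close> and cut
  \<open>y\<close> into \<open>f\<close> and \<open>g\<close> at degree \<open>l\<close>; the
  Euclidean step separates the two.\<close>

lemma sum_wt_qform_inverse_append:
  fixes a :: "nat \<Rightarrow> 'a::{field,finite}"
  assumes V: "V $ 0 \<noteq> 0"
  shows "(\<Sum>x\<in>vecs n (l + Suc k). wt (qform n a (inverse V) (2 * l + k) x)) =
         (\<Sum>f\<in>vecs n l. \<Sum>g\<in>vecs n (Suc k). wt (- qform n a V (2 * l + k) f + qform n a V k g))"
proof -
  let ?P = "l + Suc k"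
  have "(\<Sum>x\<in>vecs n ?P. wt (qform n a (inverse V) (2 * l + k) x)) =
      (\<Sum>y\<in>vecs n ?P. wt (qform n a (inverse V) (2 * l + k) (\<lambda>i. fps_cutoff ?P (V * y i))))"
    by (rule sum_vecs_map[OF bij_betw_cutoff_mult[OF V]]) (simp cong: qform_cong)
  also have "\<dots> = (\<Sum>f\<in>vecs n l. \<Sum>g\<in>vecs n (Suc k). wt (qform n a (inverse V) (2 * l + k)
        (\<lambda>i. fps_cutoff ?P (V * (f i + fps_X ^ l * g i)))))"
    by (rule sum_vecs_append) (simp cong: qform_cong)
  also have "\<dots> = (\<Sum>f\<in>vecs n l. \<Sum>g\<in>vecs n (Suc k). wt (- qform n a V (2 * l + k) f + qform n a V k g))"
  proof (intro sum.cong refl arg_cong[where f = wt])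
    fix f g :: "nat \<Rightarrow> 'a fps" assume f: "f \<in> vecs n l"
    show "qform n a (inverse V) (2 * l + k) (\<lambda>i. fps_cutoff ?P (V * (f i + fps_X ^ l * g i))) =
        - qform n a V (2 * l + k) f + qform n a V k g"
      unfolding qform_def
      using inverse_mult_cutoff_square_append_nth[OF V vecsD[OF f]]
      by (simp add: right_diff_distrib sum_subtractf)
  qed
  finally show ?thesis .
qed

text \<open>Degenerate case: for \<open>D < P - 1\<close> neither the truncation of
  \<open>V * y\<close> nor the coefficients of \<open>y\<close> beyond degree \<open>D\<close>
  affect the form, so the latter are free.\<close>

lemma sum_wt_qform_inverse_small:
  fixes a :: "nat \<Rightarrow> 'a::{field,finite}"
  assumes V: "V $ 0 \<noteq> 0" and D: "Suc D < P"
  shows "(\<Sum>x\<in>vecs n P. wt (qform n a (inverse V) D x)) =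
         real CARD('a) ^ (n * (P - Suc D)) * (\<Sum>g\<in>vecs n (Suc D). wt (qform n a V D g))"
proof -
  have eq: "(inverse V * fps_cutoff P (V * y) ^ 2) $ D = (V * fps_cutoff (Suc D) y ^ 2) $ D" for y
  proof -
    have "V * y - fps_cutoff P (V * y) = fps_X ^ P * fps_shift P (V * y)"
      using fps_shift_cutoff'[of P "V * y"] by (simp add: algebra_simps)
    then have "(y * (V * y - fps_cutoff P (V * y))) $ D = 0"
      using D by (simp add: mult.left_commute[of y] fps_X_power_mult_nth)
    then have "(inverse V * fps_cutoff P (V * y) ^ 2) $ D = (V * y^2) $ D"
      using inverse_mult_cutoff_square_nth[OF V, of D P y] D by simp
    also have "\<dots> = (V * fps_cutoff (Suc D) (y^2)) $ D"
      by (simp add: fps_cutoff_right_mult_nth)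
    also have "fps_cutoff (Suc D) (y^2) = fps_cutoff (Suc D) (fps_cutoff (Suc D) y ^ 2)"
      by (simp add: power2_eq_square fps_cutoff_eq_fps_cutoff_iff fps_cutoff_left_mult_nth fps_cutoff_right_mult_nth)
    finally show ?thesis by (simp add: fps_cutoff_right_mult_nth)
  qed
  have "(\<Sum>x\<in>vecs n P. wt (qform n a (inverse V) D x)) =
      (\<Sum>y\<in>vecs n P. wt (qform n a (inverse V) D (\<lambda>i. fps_cutoff P (V * y i))))"
    by (rule sum_vecs_map[OF bij_betw_cutoff_mult[OF V]]) (simp cong: qform_cong)
  also have "\<dots> = (\<Sum>y\<in>vecs n (Suc D + (P - Suc D)). wt (qform n a V D (\<lambda>i. fps_cutoff (Suc D) (y i))))"
    using D by (simp add: qform_def eq)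
  also have "\<dots> = (\<Sum>g\<in>vecs n (Suc D). \<Sum>h\<in>vecs n (P - Suc D).
      wt (qform n a V D (\<lambda>i. fps_cutoff (Suc D) (g i + fps_X ^ Suc D * h i))))"
    by (rule sum_vecs_append) (simp cong: qform_cong)
  also have "\<dots> = (\<Sum>g\<in>vecs n (Suc D). \<Sum>h\<in>(vecs n (P - Suc D) :: (nat \<Rightarrow> 'a fps) set). wt (qform n a V D g))"
  proof (rule sum.cong[OF refl], rule sum.cong[OF refl])
    fix g h :: "nat \<Rightarrow> 'a fps" assume "g \<in> vecs n (Suc D)" "h \<in> vecs n (P - Suc D)"
    then show "wt (qform n a V D (\<lambda>i. fps_cutoff (Suc D) (g i + fps_X ^ Suc D * h i))) = wt (qform n a V D g)"
      by (intro arg_cong[where f = wt] qform_cong) (rule fps_below_append(2)[OF vecsD vecsD])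
  qed
  finally show ?thesis by (simp add: card_vecs sum_distrib_left)
qed

section \<open>Recursion in the degree bound\<close>

lemma qform_eq_0_of_below:
  assumes "x \<in> vecs n l" "A \<in> fps_below m" "2 * l + m \<le> D + 2" "0 < l"
  shows "qform n a A D x = 0"
proof -
  have "(A * x i ^ 2) $ D = 0" if "i < n" for i
  proof -
    have "x i * x i \<in> fps_below (2 * l - 1)"
      using fps_mult_below_nth_eq_0[OF vecsD vecsD, OF assms(1) that assms(1) that]
      by (simp add: fps_below_def)
    then show ?thesis
      using assms unfolding power2_eq_square by (intro fps_mult_below_nth_eq_0) auto
  qed
  then show ?thesis by (simp add: qform_def)
qed

lemma qform_vecs_0: "x \<in> vecs n 0 \<Longrightarrow> qform n a A D x = 0"
  using vecsD[of x n 0] by (simp add: qform_def)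

lemma qform_add: "qform n a (A + B) D x = qform n a A D x + qform n a B D x"
  by (simp add: qform_def algebra_simps sum.distrib)

text \<open>For \<open>P = l + k + 1\<close> this is the contribution of all \<open>A\<close> of
  order \<open>k\<close> after the Euclidean step. The anti-triangular block in \<open>g\<close>
  sees the coefficients \<open>0\<close> to \<open>k\<close> of \<open>V\<close>, the remaining
  Hankel form in \<open>f\<close> only those from \<open>k + 2\<close> on.\<close>

definition block_sum :: "nat \<Rightarrow> (nat \<Rightarrow> 'a::{field,finite}) \<Rightarrow> nat \<Rightarrow> nat \<Rightarrow> real" where
  "block_sum n a l k = (\<Sum>V\<in>fps_units_below (2 * l + k + 1). \<Sum>f\<in>vecs n l. \<Sum>g\<in>vecs n (Suc k).
     wt (- qform n a V (2 * l + k) f + qform n a V k g))"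

text \<open>The value at \<open>P = 0\<close> makes the recursion \<open>total_sum_eq\<close> uniform.\<close>

definition total_sum :: "nat \<Rightarrow> (nat \<Rightarrow> 'a::{field,finite}) \<Rightarrow> nat \<Rightarrow> real" where
  "total_sum n a P = (if P = 0 then (real CARD('a) - 1) / real CARD('a)
     else \<Sum>A\<in>fps_below (2 * P - 1). hankel_sum n a P A)"

text \<open>The block has odd size \<open>2 * j + 1\<close>, so of \<open>V\<close> its sum involves
  only \<open>v = V $ 0\<close>, which the form in \<open>f\<close> cannot see. Summing over
  \<open>v\<close> first gives 0 by \<open>sum_wt_scaled_odd\<close>.\<close>

lemma block_sum_even:
  fixes a :: "nat \<Rightarrow> 'a::{field,finite}"
  assumes q: "odd (CARD('a))" and n: "odd n" and a: "\<forall>i<n. a i \<noteq> 0"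
  shows "block_sum n a l (2 * j) = 0"
proof -
  let ?D = "2 * l + 2 * j"
  let ?W = "\<lambda>v c. \<Sum>u\<in>{..<n} \<rightarrow>\<^sub>E UNIV. wt (c + v * (\<Sum>i<n. a i * (u i)^2))"
  have Q: "qform n a (fps_const v + fps_X * A) ?D f = qform n a (fps_X * A) ?D f"
    if "f \<in> vecs n l" for v A f
  proof (cases "l = 0")
    case False
    then have "qform n a (fps_const v) ?D f = 0"
      using that by (intro qform_eq_0_of_below[where m = 1 and l = l]) (auto simp: fps_below_def)
    then show ?thesis by (simp add: qform_add)
  qed (use that in \<open>simp add: qform_vecs_0\<close>)
  have "block_sum n a l (2 * j) = (\<Sum>V\<in>fps_units_below (1 + ?D). \<Sum>f\<in>vecs n l.
      real CARD('a) ^ (n * j) * ?W (V $ 0) (- qform n a V ?D f))"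
    unfolding block_sum_def
    by (intro sum.cong sum_wt_qform_odd[OF q a]) (simp_all add: fps_units_below_def)
  also have "\<dots> = (\<Sum>v\<in>UNIV - {0}. \<Sum>A\<in>fps_below ?D. \<Sum>f\<in>vecs n l.
      real CARD('a) ^ (n * j) * ?W v (- qform n a (fps_X * A) ?D f))"
    by (subst sum_fps_units_below_append, simp, subst sum_fps_units_below_1)
       (intro sum.cong refl, simp add: Q)
  also have "\<dots> = (\<Sum>A\<in>fps_below ?D. \<Sum>f\<in>vecs n l.
      real CARD('a) ^ (n * j) * (\<Sum>v\<in>UNIV - {0}. ?W v (- qform n a (fps_X * A) ?D f)))"
    by (subst sum.swap, subst sum.swap) (simp add: sum_distrib_left)
  also have "\<dots> = 0"
    by (simp only: sum_wt_scaled_odd[OF q n a] mult_zero_right sum.neutral_const)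
  finally show ?thesis .
qed

text \<open>The hyperbolic block contributes \<open>q ^ (n * j)\<close>. For \<open>l > 0\<close>
  what remains ignores the first \<open>k + 2\<close> coefficients of \<open>V\<close>, chosen in
  \<open>(q - 1) * q ^ (k + 1)\<close> ways, while the other \<open>2 * l - 1\<close> run over all
  Hankel forms of size \<open>l\<close>.\<close>

lemma block_sum_odd:
  fixes a :: "nat \<Rightarrow> 'a::{field,finite}"
  assumes q: "odd (CARD('a))" and a: "\<forall>i<n. a i \<noteq> 0" and k: "Suc k = 2 * j"
  shows "block_sum n a l k = (real CARD('a) - 1) * real CARD('a) ^ (Suc k + n * j) * total_sum n a l"
proof -
  let ?q = "real CARD('a)"
  let ?G = "\<lambda>V. \<Sum>f\<in>vecs n l. wt (qform n a V (2 * l + k) f)"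
  have even: "(\<Sum>g\<in>vecs n (Suc k). wt (c + qform n a V k g)) = ?q ^ (n * j) * wt c"
    if "V $ 0 \<noteq> 0" for V c
    using sum_wt_qform_even[OF q a that k] by (simp add: k)
  have "block_sum n a l k = (\<Sum>V\<in>fps_units_below (2 * l + k + 1). ?q ^ (n * j) * ?G V)"
    unfolding block_sum_def sum_distrib_left
    by (intro sum.cong refl) (simp add: even fps_units_below_def del: uminus_add_conv_diff)
  also have "\<dots> = ?q ^ (n * j) * (\<Sum>V\<in>fps_units_below (2 * l + k + 1). ?G V)"
    by (simp add: sum_distrib_left)
  also have "(\<Sum>V\<in>fps_units_below (2 * l + k + 1). ?G V) = (?q - 1) * ?q ^ Suc k * total_sum n a l"
  proof (cases "l = 0")
    \<comment> \<open>Here \<open>V\<close> has only \<open>k + 1\<close> coefficients, one fewer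
      than \<open>k + 2\<close>; the denominator in \<open>total_sum n a 0\<close> makes up for
      it.\<close>
    case True
    then show ?thesis
      by (simp add: total_sum_def qform_vecs_0 card_vecs card_fps_units_below power2_eq_square)
  next
    case False
    have G: "?G (B + fps_X ^ (k + 2) * A) = hankel_sum n a l A" if "B \<in> fps_units_below (k + 2)" for A B
      unfolding hankel_sum_def
    proof (intro sum.cong refl arg_cong[where f = wt])
      fix f :: "nat \<Rightarrow> 'a fps" assume f: "f \<in> vecs n l"
      have "qform n a B (2 * l + k) f = 0"
        using f that False by (intro qform_eq_0_of_below[where m = "k + 2" and l = l]) (auto simp: fps_units_below_def)
      moreover have "2 * l + k = (k + 2) + (2 * l - 2)" using False by simp
      ultimately show "qform n a (B + fps_X ^ (k + 2) * A) (2 * l + k) f = qform n a A (2 * l - 2) f"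
        by (metis qform_add qform_shift add_0)
    qed
    have "(\<Sum>V\<in>fps_units_below (2 * l + k + 1). ?G V) = (\<Sum>V\<in>fps_units_below ((k + 2) + (2 * l - 1)). ?G V)"
      using False by (intro arg_cong[where f = "\<lambda>m. sum ?G (fps_units_below m)"]) simp
    also have "\<dots> = (\<Sum>B\<in>(fps_units_below (k + 2) :: 'a fps set). \<Sum>A\<in>fps_below (2 * l - 1). hankel_sum n a l A)"
      by (subst sum_fps_units_below_append) (auto intro!: sum.cong simp del: add_2_eq_Suc' simp: G)
    also have "\<dots> = (?q - 1) * ?q ^ Suc k * total_sum n a l"
      using False card_fps_units_below[where 'a = 'a, of "Suc k"] by (simp add: total_sum_def)
    finally show ?thesis .
  qed
  finally show ?thesis by (simp add: power_add mult_ac)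
qed

text \<open>The first term comes from \<open>A = 0\<close>. Orders \<open>k < P\<close> admit the
  Euclidean step with \<open>l = P - 1 - k\<close>. For \<open>k \<ge> P\<close> the coefficient
  read is \<open>D = 2 * P - 2 - k < P - 1\<close>: the degenerate case, a pure block with
  \<open>P - 1 - D\<close> free coefficients per variable.\<close>

lemma total_sum_eq:
  fixes a :: "nat \<Rightarrow> 'a::{field,finite}"
  assumes "0 < P"
  shows "total_sum n a P = (real CARD('a) - 1) * real CARD('a) ^ (n * P) +
     (\<Sum>k<P. block_sum n a (P - 1 - k) k) +
     (\<Sum>D<P - 1. real CARD('a) ^ (n * (P - 1 - D)) * block_sum n a 0 D)"
proof -
  let ?q = "real CARD('a)"
  let ?F = "\<lambda>k. \<Sum>U\<in>fps_units_below (2 * P - 1 - k). hankel_sum n a P (fps_X ^ k * U)"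
  have F: "?F k = (\<Sum>V\<in>fps_units_below (Suc D). \<Sum>x\<in>vecs n P. wt (qform n a (inverse V) D x))"
    if "k + D = 2 * P - 2" for k D
  proof -
    have "2 * P - 1 - k = Suc D" using that assms by simp
    then show ?thesis
      using hankel_sum_shift_cutoff[OF refl that, of n a]
      by (subst sum_fps_units_below_inverse) simp
  qed
  have lt: "?F k = block_sum n a (P - 1 - k) k" if "k < P" for k
  proof -
    let ?l = "P - 1 - k"
    have P: "P = ?l + Suc k" using that by simp
    have "?F k = (\<Sum>V\<in>fps_units_below (Suc (2 * ?l + k)). \<Sum>x\<in>vecs n P. wt (qform n a (inverse V) (2 * ?l + k) x))"
      by (rule F) (use that in simp)
    also have "\<dots> = block_sum n a ?l k"
      unfolding block_sum_def
    proof (rule sum.cong)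
      fix V :: "'a fps" assume "V \<in> fps_units_below (2 * ?l + k + 1)"
      then show "(\<Sum>x\<in>vecs n P. wt (qform n a (inverse V) (2 * ?l + k) x)) =
          (\<Sum>f\<in>vecs n ?l. \<Sum>g\<in>vecs n (Suc k). wt (- qform n a V (2 * ?l + k) f + qform n a V k g))"
        by (subst P) (rule sum_wt_qform_inverse_append, simp add: fps_units_below_def)
    qed simp
    finally show ?thesis .
  qed
  have ge: "?F k = ?q ^ (n * (P - 1 - D)) * block_sum n a 0 D" if "k + D = 2 * P - 2" "D < P - 1" for k D
  proof -
    have "?F k = (\<Sum>V\<in>fps_units_below (Suc D). \<Sum>x\<in>vecs n P. wt (qform n a (inverse V) D x))"
      by (rule F) fact
    also have "\<dots> = (\<Sum>V\<in>fps_units_below (Suc D). ?q ^ (n * (P - Suc D)) * (\<Sum>g\<in>vecs n (Suc D). wt (qform n a V D g)))"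
      using that by (intro sum.cong refl sum_wt_qform_inverse_small) (auto simp: fps_units_below_def)
    also have "\<dots> = ?q ^ (n * (P - 1 - D)) * block_sum n a 0 D"
      by (simp add: block_sum_def qform_vecs_0 card_vecs sum_distrib_left)
    finally show ?thesis .
  qed
  have zero: "hankel_sum n a P 0 = (?q - 1) * ?q ^ (n * P)"
    by (simp add: hankel_sum_def qform_def card_vecs)
  have "total_sum n a P = hankel_sum n a P 0 + (\<Sum>k<2 * P - 1. ?F k)"
    using assms unfolding total_sum_def by (simp add: sum_fps_below_by_subdegree)
  also have "(\<Sum>k<2 * P - 1. ?F k) = (\<Sum>k<P. ?F k) + (\<Sum>k\<in>{P..<2 * P - 1}. ?F k)"
    using assms by (subst sum.union_disjoint[symmetric]) (auto intro!: sum.cong)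
  also have "(\<Sum>k\<in>{P..<2 * P - 1}. ?F k) = (\<Sum>D<P - 1. ?q ^ (n * (P - 1 - D)) * block_sum n a 0 D)"
  proof (rule sum.reindex_bij_witness[of _ "\<lambda>D. 2 * P - 2 - D" "\<lambda>k. 2 * P - 2 - k"])
    fix k assume "k \<in> {P..<2 * P - 1}"
    then show "?q ^ (n * (P - 1 - (2 * P - 2 - k))) * block_sum n a 0 (2 * P - 2 - k) = ?F k"
      by (intro ge[symmetric]) auto
  qed auto
  also have "(\<Sum>k<P. ?F k) = (\<Sum>k<P. block_sum n a (P - 1 - k) k)"
    by (intro sum.cong refl lt) simp
  finally show ?thesis by (simp only: zero add.assoc)
qed

text \<open>Raising \<open>k\<close> by 2 multiplies a block sum by \<open>q ^ (n + 2)\<close>. So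
  the block sums in \<open>total_sum_eq\<close> for \<open>P + 2\<close> are those for
  \<open>P\<close> times this factor, plus the terms of index 1, which are multiples of
  \<open>total_sum n a P\<close> and \<open>total_sum n a 0\<close>; index 0 gives 0.\<close>

lemma total_sum_rec:
  fixes a :: "nat \<Rightarrow> 'a::{field,finite}"
  assumes q: "odd (CARD('a))" and n: "odd n" and a: "\<forall>i<n. a i \<noteq> 0"
  shows "total_sum n a (Suc (Suc P)) = real CARD('a) ^ (n + 3) * total_sum n a P +
     (real CARD('a) - 1) * (real CARD('a) ^ (n * (P + 2)) - real CARD('a) ^ (n * (P + 1) + 1))"
proof -
  let ?q = "real CARD('a)" and ?b = "block_sum n a" and ?t = "total_sum n a"
  have b0: "?b l 0 = 0" for l
    using block_sum_even[OF q n a, of l 0] by simp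
  have b1: "?b l (Suc 0) = (?q - 1) * ?q ^ (n + 2) * ?t l" for l
    using block_sum_odd[OF q a, of "Suc 0" 1 l] by (simp add: add.commute)
  have b2: "?b l (Suc (Suc k)) = ?q ^ (n + 2) * ?b l k" for l k
  proof (cases "even k")
    case True
    then obtain j where "k = 2 * j" by blast
    then show ?thesis
      using block_sum_even[OF q n a, of l j] block_sum_even[OF q n a, of l "Suc j"] by simp
  next
    case False
    then obtain j where j: "Suc k = 2 * j" by (metis even_Suc evenE)
    then have "Suc (Suc (Suc k)) = 2 * Suc j" by simp
    from block_sum_odd[OF q a this, of l] block_sum_odd[OF q a j, of l]
    show ?thesis by (simp add: power_add mult_ac)
  qed
  show ?thesis
  proof (cases "P = 0")
    case True
    have "?q \<noteq> 0" by simp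
    then show ?thesis
      using True by (simp add: total_sum_eq[of 2, simplified] total_sum_eq[of "Suc (Suc 0)"] b0 b1 lessThan_Suc
          total_sum_def[of n a 0] power_add field_simps power2_eq_square power3_eq_cube)
  next
    case False
    have S1: "(\<Sum>k<Suc (Suc P). ?b (Suc (Suc P) - 1 - k) k) =
        (?q - 1) * ?q ^ (n + 2) * ?t P + ?q ^ (n + 2) * (\<Sum>k<P. ?b (P - 1 - k) k)"
      by (simp add: sum.lessThan_Suc_shift b0 b1 b2 sum_distrib_left del: sum.lessThan_Suc)
    have "P = Suc (P - 1)" using False by simp
    then have "(\<Sum>D<Suc (Suc P) - 1. ?q ^ (n * (Suc (Suc P) - 1 - D)) * ?b 0 D) =
       (\<Sum>D<Suc (Suc (P - 1)). ?q ^ (n * (Suc P - D)) * ?b 0 D)" by simp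
    also have "\<dots> = ?q ^ (n * P) * ((?q - 1) * ?q ^ (n + 2) * ?t 0) +
       ?q ^ (n + 2) * (\<Sum>D<P - 1. ?q ^ (n * (P - 1 - D)) * ?b 0 D)"
      by (simp add: sum.lessThan_Suc_shift b0 b1 b2 sum_distrib_left mult_ac del: sum.lessThan_Suc)
    finally have S2: "(\<Sum>D<Suc (Suc P) - 1. ?q ^ (n * (Suc (Suc P) - 1 - D)) * ?b 0 D) = \<dots>" .
    have t0: "?q * ?t 0 = ?q - 1" by (simp add: total_sum_def)
    define A where "A = (\<Sum>k<P. ?b (P - 1 - k) k)"
    define B where "B = (\<Sum>D<P - 1. ?q ^ (n * (P - 1 - D)) * ?b 0 D)"
    have tP: "?t P = (?q - 1) * ?q ^ (n * P) + A + B"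
      using False by (simp add: total_sum_eq A_def B_def)
    have "?t (Suc (Suc P)) = (?q - 1) * ?q ^ (n * Suc (Suc P)) +
       ((?q - 1) * ?q ^ (n + 2) * ?t P + ?q ^ (n + 2) * A) +
       (?q ^ (n * P) * ((?q - 1) * ?q ^ (n + 2) * ?t 0) + ?q ^ (n + 2) * B)"
      by (subst total_sum_eq) (simp_all only: S1 S2 A_def B_def zero_less_Suc)
    also have "\<dots> = (?q - 1) * ?q ^ (n * Suc (Suc P)) + (?q - 1) * ?q ^ (n + 2) * ?t P
       + ?q ^ (n + 2) * (?t P - (?q - 1) * ?q ^ (n * P)) + ?q ^ (n * P) * (?q - 1) * ?q ^ (n + 1) * (?q * ?t 0)"
      unfolding tP by (simp add: algebra_simps)
    also have "\<dots> = ?q ^ (n + 3) * ?t P + (?q - 1) * (?q ^ (n * (P + 2)) - ?q ^ (n * (P + 1) + 1))"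
      unfolding t0 by (simp add: algebra_simps power_add power2_eq_square power3_eq_cube)
    finally show ?thesis .
  qed
qed

section \<open>Counting zeros\<close>

lemma fps_of_poly_in_fps_below_iff:
  "fps_of_poly p \<in> fps_below P \<longleftrightarrow> p = 0 \<or> degree p < P"
proof
  assume *: "fps_of_poly p \<in> fps_below P"
  show "p = 0 \<or> degree p < P"
  proof (rule ccontr)
    assume "\<not> (p = 0 \<or> degree p < P)"
    with * have "lead_coeff p = 0" by (auto simp: fps_below_def)
    with \<open>\<not> (p = 0 \<or> degree p < P)\<close> show False by simp
  qed
qed (auto simp: fps_below_def coeff_eq_0)

lemma fps_below_obtain_poly:
  fixes f :: "'a::comm_monoid_add fps"
  assumes "f \<in> fps_below P"
  obtains p where "f = fps_of_poly p"
proof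
  show "f = fps_of_poly (\<Sum>l<P. monom (f $ l) l)"
  proof (rule fps_ext)
    fix k
    have "coeff (\<Sum>l<P. monom (f $ l) l) k = (\<Sum>l<P. if l = k then f $ l else 0)"
      by (simp add: coeff_sum)
    also have "\<dots> = f $ k" using assms by (simp add: fps_belowD)
    finally show "f $ k = fps_of_poly (\<Sum>l<P. monom (f $ l) l) $ k" by simp
  qed
qed

lemma count_N_eq_card_vecs:
  fixes a :: "nat \<Rightarrow> 'a::{field,finite}"
  shows "count_N n a P = card {x \<in> vecs n P. (\<Sum>i<n. fps_const (a i) * x i ^ 2) = 0}"
proof -
  define S where "S = {x :: nat \<Rightarrow> 'a poly. (\<forall>i. n \<le> i \<longrightarrow> x i = 0) \<and>
    (\<forall>i<n. x i = 0 \<or> degree (x i) < P) \<and> diag_form n a x = 0}"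
  define T where "T = {x :: nat \<Rightarrow> 'a fps. x \<in> vecs n P \<and> (\<Sum>i<n. fps_const (a i) * x i ^ 2) = 0}"
  let ?h = "\<lambda>x :: nat \<Rightarrow> 'a poly. \<lambda>i\<in>{..<n}. fps_of_poly (x i)"
  have F: "(\<Sum>i<n. fps_const (a i) * fps_of_poly (x i) ^ 2) = fps_of_poly (diag_form n a x)" for x
    by (simp add: diag_form_def fps_of_poly_sum fps_of_poly_smult fps_of_poly_power)
  have "bij_betw ?h S T"
  proof (rule bij_betw_imageI)
    show "inj_on ?h S"
    proof (rule inj_onI, rule ext)
      fix x y :: "nat \<Rightarrow> 'a poly" and i
      assume xy: "x \<in> S" "y \<in> S" "?h x = ?h y"
      show "x i = y i"
      proof (cases "i < n")
        case True
        with fun_cong[OF xy(3), of i] show ?thesis by simp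
      qed (use xy in \<open>simp add: S_def\<close>)
    qed
    show "?h ` S = T"
    proof (intro subset_antisym subsetI)
      fix y assume "y \<in> ?h ` S"
      then show "y \<in> T"
        by (auto simp: S_def T_def vecs_def F fps_of_poly_in_fps_below_iff split: if_splits)
    next
      fix y assume y: "y \<in> T"
      have "\<exists>p. y i = fps_of_poly p" if "i < n" for i
        using y that fps_below_obtain_poly[OF vecsD[of y n P i]] by (auto simp: T_def)
      then obtain p where p: "y i = fps_of_poly (p i)" if "i < n" for i by metis
      let ?x = "\<lambda>i. if i < n then p i else 0"
      have "fps_of_poly (diag_form n a ?x) = 0"
        using y p unfolding F[symmetric] by (simp add: T_def)
      then have x: "?x \<in> S"
        using y p vecsD[of y n P] by (auto simp: S_def T_def simp flip: fps_of_poly_in_fps_below_iff)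
      have h: "?h ?x = y"
        using y p by (auto simp: T_def vecs_def PiE_def extensional_def)
      show "y \<in> ?h ` S" using image_eqI[where f = ?h, OF h[symmetric] x] .
    qed
  qed
  then show ?thesis
    unfolding count_N_def S_def[symmetric] T_def by (metis (no_types, lifting) T_def bij_betw_same_card)
qed

text \<open>Exchange the sums over \<open>A\<close> and \<open>x\<close>. Where the form is nonzero
  the weights cancel over all functionals; at a zero each of the \<open>q ^ (2 * P - 1)\<close>
  series contributes \<open>q - 1\<close>. The extra factor \<open>q\<close> makes the equation hold
  at \<open>P = 0\<close> too.\<close>

lemma total_sum_count_N:
  fixes a :: "nat \<Rightarrow> 'a::{field,finite}"
  shows "real CARD('a) * total_sum n a P =
    (real CARD('a) - 1) * real CARD('a) ^ (2 * P) * real (count_N n a P)"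
proof (cases "P = 0")
  case True
  have "(\<Sum>i<n. fps_const (a i) * x i ^ 2) = 0" if "x \<in> vecs n 0" for x
    using vecsD[OF that] by simp
  then have "count_N n a 0 = card (vecs n 0 :: (nat \<Rightarrow> 'a fps) set)"
    unfolding count_N_eq_card_vecs by (intro arg_cong[where f = card]) auto
  then show ?thesis using True by (simp add: total_sum_def card_vecs)
next
  case False
  let ?q = "real CARD('a)"
  define D where "D = 2 * P - 2"
  let ?F = "\<lambda>x. \<Sum>i<n. fps_const (a i) * x i ^ 2"
  let ?S = "{x \<in> vecs n P. ?F x = 0}"
  have qF: "qform n a A D x = (A * ?F x) $ D" for A x
    by (simp add: qform_def sum_distrib_left fps_sum_nth mult.left_commute[of A])
  have zero: "(\<Sum>A\<in>fps_below (2 * P - 1). wt (qform n a A D x)) = 0"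
    if x: "x \<in> vecs n P" "?F x \<noteq> 0" for x
  proof -
    \<comment> \<open>The form at \<open>x\<close> has degree at most \<open>D\<close>, so its
      coefficient \<open>l\<close> is detected by translating \<open>A\<close> by multiples of
      \<open>fps_X ^ (D - l)\<close>.\<close>
    obtain l where l: "?F x $ l \<noteq> 0" using x(2) by (auto simp: fps_eq_iff)
    have "?F x $ l = 0" if "D < l"
      using fps_mult_below_nth_eq_0[OF vecsD[OF x(1)] vecsD[OF x(1)], of _ _ l] that
      by (simp add: fps_sum_nth power2_eq_square D_def)
    with l have lD: "l \<le> D" by (meson not_less)
    show ?thesis
    proof (rule sum_wt_zero[where t = "\<lambda>b A. A + fps_const b * fps_X ^ (D - l)" and l = "?F x $ l"])
      fix b and A :: "'a fps" assume "A \<in> fps_below (2 * P - 1)"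
      then show "A + fps_const b * fps_X ^ (D - l) \<in> fps_below (2 * P - 1)"
        using lD False by (auto simp: fps_below_def D_def)
      show "A + fps_const b * fps_X ^ (D - l) + fps_const (- b) * fps_X ^ (D - l) = A"
        by (simp add: fps_eq_iff)
      show "qform n a (A + fps_const b * fps_X ^ (D - l)) D x = qform n a A D x + b * ?F x $ l"
        unfolding qF using lD by (simp add: distrib_right mult.assoc fps_X_power_mult_nth)
    qed (fact l)
  qed
  have "total_sum n a P = (\<Sum>x\<in>vecs n P. \<Sum>A\<in>fps_below (2 * P - 1). wt (qform n a A D x))"
    using False unfolding total_sum_def hankel_sum_def D_def by (simp add: sum.swap[of _ "vecs n P"])
  also have "\<dots> = (\<Sum>x\<in>?S. \<Sum>A\<in>fps_below (2 * P - 1). wt (qform n a A D x))"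
    using zero by (intro sum.mono_neutral_right) auto
  also have "\<dots> = (\<Sum>x\<in>?S. \<Sum>A\<in>(fps_below (2 * P - 1) :: 'a fps set). ?q - 1)"
    unfolding qF by (intro sum.cong refl) simp
  also have "\<dots> = real (count_N n a P) * ?q ^ (2 * P - 1) * (?q - 1)"
    by (simp add: count_N_eq_card_vecs)
  finally have "?q * total_sum n a P = (?q - 1) * (?q * ?q ^ (2 * P - 1)) * real (count_N n a P)" by simp
  also have "?q * ?q ^ (2 * P - 1) = ?q ^ (2 * P)"
    using False by (simp flip: power_Suc)
  finally show ?thesis .
qed

section \<open>Initial values, recursion and closed formulas for the number of zeros\<close>

lemma card_field_gt_1: "1 < CARD('a::{field,finite})"
proof -
  have "card {0, 1 :: 'a} \<le> CARD('a)" by (rule card_mono) auto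
  then show ?thesis by simp
qed

lemma count_N_0:
  fixes a :: "nat \<Rightarrow> 'a::{field,finite}"
  shows "count_N n a 0 = 1"
  using total_sum_count_N[of n a 0] card_field_gt_1[where 'a = 'a] by (simp add: total_sum_def)

text \<open>For \<open>P = 1\<close> every \<open>A\<close> is a constant: the nonzero ones form a
  block of size 1, whose sum is 0, so only \<open>A = 0\<close> contributes.\<close>

lemma count_N_1:
  fixes a :: "nat \<Rightarrow> 'a::{field,finite}"
  assumes q: "odd (CARD('a))" and n: "odd n" and a: "\<forall>i<n. a i \<noteq> 0"
  shows "real (count_N n a 1) = real CARD('a) ^ (n - 1)"
proof -
  let ?q = "real CARD('a)"
  have "block_sum n a 0 0 = 0"
    using block_sum_even[OF q n a, of 0 0] by simp
  then have "total_sum n a 1 = (?q - 1) * ?q ^ n"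
    by (simp add: total_sum_eq)
  moreover have "?q ^ n = ?q * ?q ^ (n - 1)"
    using n by (cases n) auto
  ultimately show ?thesis
    using total_sum_count_N[of n a 1] card_field_gt_1[where 'a = 'a] by (simp add: power2_eq_square)
qed

lemma count_N_rec:
  fixes a :: "nat \<Rightarrow> 'a::{field,finite}"
  assumes q: "odd (CARD('a))" and n: "odd n" "n = m + 2" and a: "\<forall>i<n. a i \<noteq> 0"
  shows "real (count_N n a (Suc (Suc P))) =
    real CARD('a) ^ (m + 1) * real (count_N n a P) + real CARD('a) ^ (m * Suc P) * (real CARD('a) ^ (m + 1) - 1)"
proof -
  let ?q = "real CARD('a)" and ?N = "\<lambda>P. real (count_N n a P)"
  have q1: "?q > 1" using card_field_gt_1[where 'a = 'a] by simp
  have "(?q - 1) * ?q ^ (2 * Suc (Suc P)) * ?N (Suc (Suc P)) = ?q * total_sum n a (Suc (Suc P))"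
    by (simp only: total_sum_count_N)
  also have "\<dots> = ?q ^ (n + 3) * (?q * total_sum n a P) +
      ?q * (?q - 1) * (?q ^ (n * (P + 2)) - ?q ^ (n * (P + 1) + 1))"
    unfolding total_sum_rec[OF q n(1) a] by (simp add: algebra_simps)
  also have "?q * total_sum n a P = (?q - 1) * ?q ^ (2 * P) * ?N P"
    by (rule total_sum_count_N)
  also have "?q ^ (n + 3) * ((?q - 1) * ?q ^ (2 * P) * ?N P) + ?q * (?q - 1) * (?q ^ (n * (P + 2)) - ?q ^ (n * (P + 1) + 1)) =
      (?q - 1) * ?q ^ (2 * Suc (Suc P)) * (?q ^ (m + 1) * ?N P + ?q ^ (m * Suc P) * (?q ^ (m + 1) - 1))"
  proof -
    have "n + 3 = m + 5" "n * (P + 2) = m * P + 2 * P + m + m + 4" "n * (P + 1) + 1 = m * P + 2 * P + m + 3"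
      "2 * Suc (Suc P) = 2 * P + 4" "m * Suc P = m * P + m"
      by (simp_all add: n(2) algebra_simps)
    then have e: "?q ^ (n + 3) = ?q ^ m * ?q ^ 5"
      "?q ^ (n * (P + 2)) = ?q ^ (m * P) * ?q ^ (2 * P) * ?q ^ m * ?q ^ m * ?q ^ 4"
      "?q ^ (n * (P + 1) + 1) = ?q ^ (m * P) * ?q ^ (2 * P) * ?q ^ m * ?q ^ 3"
      "?q ^ (2 * Suc (Suc P)) = ?q ^ (2 * P) * ?q ^ 4"
      "?q ^ (m * Suc P) = ?q ^ (m * P) * ?q ^ m" "?q ^ (m + 1) = ?q ^ m * ?q"
      by (simp_all only: power_add power_one_right)
    \<comment> \<open>Here \<open>A\<close>, \<open>M\<close>, \<open>Z\<close>, \<open>N\<close>,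
      \<open>x\<close> stand for \<open>q ^ m\<close>, \<open>q ^ (m * P)\<close>,
      \<open>q ^ (2 * P)\<close>, the count at \<open>P\<close>, and \<open>q\<close>.\<close>
    have "A * x^5 * ((x - 1) * Z * N) + x * (x - 1) * (M * Z * A * A * x^4 - M * Z * A * x^3) =
        (x - 1) * (Z * x^4) * (A * x * N + M * A * (A * x - 1))" for A M N Z x :: real
      by (simp add: algebra_simps eval_nat_numeral)
    then show ?thesis unfolding e by blast
  qed
  finally show ?thesis using q1 by simp
qed

text \<open>Resonant case: the inhomogeneous term grows like the homogeneous solution
  \<open>q ^ P\<close>, whence the factor \<open>P\<close>; the second homogeneous solution
  \<open>(- q) ^ P\<close> causes the dependence on parity.\<close>

lemma recurrence_solution_1:
  fixes N :: "nat \<Rightarrow> real"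
  assumes q: "q > 0" and N: "N 0 = 1" "N (Suc 0) = q^2"
    and rec: "\<And>P. N (Suc (Suc P)) = q^2 * N P + q ^ Suc P * (q^2 - 1)"
  shows "N P = (q^2 - 1) / (2*q) * real P * q^P + (if even P then 1 else (q^2 + 1) / (2*q)) * q^P"
proof (induction P rule: nat_induct2)
  case (step P)
  have "N (P + 2) = q^2 * N P + q ^ Suc P * (q^2 - 1)"
    using rec[of P] by simp
  then show ?case
    unfolding step using q by (simp add: field_simps power2_eq_square)
qed (use assms in \<open>simp_all add: field_simps power2_eq_square\<close>)

text \<open>The inhomogeneity contributes a multiple of \<open>q ^ ((2 * r + 1) * P)\<close>; the
  homogeneous part is \<open>q ^ ((r + 1) * P)\<close> with a coefficient depending on the parity of
  \<open>P\<close>, fixed by the two initial values.\<close>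

lemma recurrence_solution:
  fixes N :: "nat \<Rightarrow> real"
  assumes q: "q > 1" "r \<noteq> 0" and N: "N 0 = 1" "N (Suc 0) = q ^ (2 * r + 2)"
    and rec: "\<And>P. N (Suc (Suc P)) = q ^ (2 * r + 2) * N P + q ^ ((2 * r + 1) * Suc P) * (q ^ (2 * r + 2) - 1)"
  shows "N P = (q ^ (2 * r + 2) - 1) / (q ^ (2 * r + 1) - q) * q ^ (P * (2 * r + 1)) -
    (if even P then (q - 1) * (q ^ (2 * r + 1) + 1) else (q^2 - 1) * q ^ r) / (q ^ (2 * r + 1) - q) * q ^ ((r + 1) * P)"
proof -
  let ?d = "q ^ (2 * r + 1) - q" and ?e = "\<lambda>P. if even P then (q - 1) * (q ^ (2 * r + 1) + 1) else (q^2 - 1) * q ^ r"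
  \<comment> \<open>This is where \<open>r \<noteq> 0\<close> excludes the resonance.\<close>
  have "q ^ 1 < q ^ (2 * r + 1)"
    using q by (intro power_strict_increasing) auto
  then have d: "?d \<noteq> 0" unfolding power_one_right by linarith
  have "?d * N P = (q ^ (2 * r + 2) - 1) * q ^ (P * (2 * r + 1)) - ?e P * q ^ ((r + 1) * P)"
  proof (induction P rule: nat_induct2)
    case (step P)
    have NP: "N (P + 2) = q ^ (2 * r + 2) * N P + q ^ ((2 * r + 1) * Suc P) * (q ^ (2 * r + 2) - 1)"
      using rec[of P] by simp
    have "?d * N (P + 2) = q ^ (2 * r + 2) * (?d * N P) + ?d * (q ^ ((2 * r + 1) * Suc P) * (q ^ (2 * r + 2) - 1))"
      unfolding NP by (simp only: distrib_left mult.left_commute)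
    also have "\<dots> = (q ^ (2 * r + 2) - 1) * q ^ ((P + 2) * (2 * r + 1)) - ?e P * q ^ ((r + 1) * (P + 2))"
    proof -
      have "2 * r + 2 = r + r + 1 + 1" "2 * r + 1 = r + r + 1" "P * (2 * r + 1) = P * r + P * r + P"
        "(2 * r + 1) * Suc P = P * r + P * r + P + r + r + 1"
        "(P + 2) * (2 * r + 1) = P * r + P * r + P + r + r + r + r + 1 + 1"
        "(r + 1) * P = P * r + P" "(r + 1) * (P + 2) = P * r + P + r + r + 1 + 1"
        by (simp_all add: algebra_simps)
      then show ?thesis
        unfolding step by (simp only: power_add power_one_right) (simp add: algebra_simps)
    qed
    finally show ?case by simp
  qed (simp_all add: N algebra_simps power_add power2_eq_square mult_2_right)
  then have "N P = ((q ^ (2 * r + 2) - 1) * q ^ (P * (2 * r + 1)) - ?e P * q ^ ((r + 1) * P)) / ?d"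
    using d by (metis nonzero_mult_div_cancel_left)
  then show ?thesis
    by (simp only: diff_divide_distrib[of "_ * _"] times_divide_eq_left)
qed

theorem theorem5p8:
  fixes a :: "nat \<Rightarrow> 'a::{field,finite}" and n P :: nat
  assumes "odd (CARD('a))"
    and "odd n" and "n \<ge> 3"
    and "\<forall>i<n. a i \<noteq> 0"
    and "P \<ge> 1"
  shows "let q = real (CARD('a)) in
    real (count_N n a P) =
     (if n = 3 then
        (if even P then (q^2 - 1) / (2*q) * real P * q^P + q^P
         else (q^2 - 1) / (2*q) * real P * q^P + (q^2 + 1) / (2*q) * q^P)
      else
        (if even P then
           (q^(n-1) - 1) / (q^(n-2) - q) * q^(P*(n-2))
             - (q - 1) * (q^(n-2) + 1) / (q^(n-2) - q) * q^((n-1) div 2 * P)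
         else
           (q^(n-1) - 1) / (q^(n-2) - q) * q^(P*(n-2))
             - (q^2 - 1) * q^((n-3) div 2) / (q^(n-2) - q) * q^((n-1) div 2 * P)))"
proof -
  define q where "q = real CARD('a)"
  define N where "N = (\<lambda>P. real (count_N n a P))"
  obtain r where r: "n = 2 * r + 3"
    using assms(2,3) by (metis add.commute even_add le_add_diff_inverse dvd_def odd_numeral)
  have q1: "q > 1" using card_field_gt_1[where 'a = 'a] by (simp add: q_def)
  have N0: "N 0 = 1" by (simp add: N_def count_N_0)
  have N1: "N (Suc 0) = q ^ (2 * r + 2)"
    using count_N_1[OF assms(1,2,4)] by (simp add: N_def q_def r)
  have rec: "N (Suc (Suc P)) = q ^ (2 * r + 2) * N P + q ^ ((2 * r + 1) * Suc P) * (q ^ (2 * r + 2) - 1)" for P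
    using count_N_rec[OF assms(1,2) _ assms(4), of "2 * r + 1" P] by (simp add: N_def q_def r)
  show ?thesis
  proof (cases "r = 0")
    case True
    have "N P = (q^2 - 1) / (2*q) * real P * q^P + (if even P then 1 else (q^2 + 1) / (2*q)) * q^P"
      by (rule recurrence_solution_1) (use q1 N0 N1 rec True in \<open>simp_all add: power2_eq_square\<close>)
    then show ?thesis
      using True r by (simp add: N_def q_def Let_def)
  next
    case False
    note recurrence_solution[OF q1 False N0 N1 rec, of P]
    moreover have "n - 1 = 2 * r + 2" "n - 2 = 2 * r + 1" "(n - 1) div 2 = r + 1" "(n - 3) div 2 = r" "n \<noteq> 3"
      using r False by simp_all
    ultimately show ?thesis
      unfolding Let_def q_def[symmetric] N_def by (cases "even P") simp_all
  qed
qed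

end
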